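(* Let $P_1,\dots,P_d$ be path graphs of lengths $n_1,\dots,n_d$ respectively, and let $G=P_1\,\Box\,\cdots\,\Box\,P_d$ be a simple grid. The following statements hold. (i) $G$ is not controllable (respectively, not observable) from a node $i=[(i)_1,\dots,(i)_d]$, $(i)_\kappa\in\{1,\dots,n_\kappa\}$, if and only if there exists $\ell\in\{1,\dots,d\}$ such that $$n_\ell-(i)_\ell\equiv (i)_\ell-1 \pmod p \qquad ( * )$$ for some odd prime $p$ dividing $n_\ell$. (ii) For every direction $\ell\in\{1,\dots,d\}$ and every odd prime factor $p$ of $n_\ell$, $G$ is not controllable (respectively, not observable) from the set of nodes $$I_s^\ell=\Big\{[(i)_1,\dots,(i)_d]\;:\;(i)_\ell=jp-\tfrac{p-1}{2},\ j\in\{1,\dots,\tfrac{n_\ell}{p}\},\ (i)_\mu\in\{1,\dots,n_\mu\}\text{ arbitrary for }\mu\ne\ell\Big\},$$ with the following uncontrollable (respectively, unobservable) eigenvalues $$\lambda_{\nu,\ell}=2-2\cos\Big((2\nu-1)\frac{\pi}{p}\Big)+\lambda_1+\dots+\lambda_{\ell-1}+\lambda_{\ell+1}+\dots+\lambda_d$$ and uncontrollable (respectively, unobservable) eigenvectors $$w_{\nu,\ell}=u_1\otimes\cdots\otimes u_{\ell-1}\otimes V_{\nu,\ell}\otimes u_{\ell+1}\otimes\cdots\otimes u_d,$$ where $\nu\in\{1,\dots,(p-1)/2\}$, $V_{\nu,\ell}=V_\nu(n_\ell,p)$ is the vector defined in the context, and for each $\mu\neq\ell$, $\lambda_\mu$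 is any eigenvalue of the Laplacian of $P_\mu$ and $u_\mu$ a corresponding eigenvector. (iii) Let $i=[(i)_1,\dots,(i)_d]$ be a node, and suppose that $( * )$ holds for exactly $r$ distinct directions, $1\le r\le d$, forming the set $R\subset\{1,\dots,d\}$, and that for each $\ell\in R$ it holds exactly for the $k_\ell$ distinct odd prime factors $q_{\ell,1},\dots,q_{\ell,k_\ell}$ of $n_\ell$. Then the set of uncontrollable (respectively, unobservable) eigenvalues of $G$ from the node $i$ is the union, over $\ell\in R$, of the sets of eigenvalues of the form $$\lambda_\ell=\bar\lambda+\lambda_1+\dots+\lambda_{\ell-1}+\lambda_{\ell+1}+\dots+\lambda_d,$$ where each $\lambda_\mu$, $\mu\ne\ell$, is an arbitrary Laplacian eigenvalue of $P_\mu$ and $\bar\lambda$ is an uncontrollable (respectively, unobservable) eigenvalue of the path $P_\ell$ from $(i)_\ell$, which has the structure $$\bar\lambda=2-2\cos\Big((2\nu-1)\frac{\pi}{Q_\ell}\Big),\qquad \nu\in\{1,\dots,\tfrac{Q_\ell-1}{2}\},\qquad Q_\ell=\prod_{j=1}^{k_\ell}q_{\ell,j}^{\alpha_{\ell,j}},$$ with $\alpha_{\ell,j}$ the largest integer $\alpha\geq 1$ such that $q_{\ell,j}^{\alpha}$ divides $n_\ell$ and $(i)_\ell\in\{h\,q_{\ell,j}^{\alpha}-\frac{q_{\ell,j}^{\alpha}-1}{2}: h\in\{1,\dots,n_\ell/q_{\ell,j}^{\alpha}\}\}$. The corresponding uncontrollable (respectively, unobservable) eigenvectors are built as $u_1\otimes\cdots\otimes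 u_{\ell-1}\otimes V_\nu(n_\ell,Q_\ell)\otimes u_{\ell+1}\otimes\cdots\otimes u_d$, with $u_\mu$ an eigenvector of $P_\mu$ for $\lambda_\mu$.
   Context: The path graph $P$ of length $n$ has node set $\{1,\dots,n\}$ and edges $(i,i+1)$, $1\le i\le n-1$. The Laplacian of a graph is $L=D-A$ (degree matrix minus adjacency matrix). A $d$-dimensional grid graph is the Cartesian product $P_1\Box\cdots\Box P_d$ of $d$ paths; its nodes are written $[(i)_1,\dots,(i)_d]$ with $(i)_\kappa\in\{1,\dots,n_\kappa\}$, and vectors on the grid are indexed lexicographically, so that $(v_1\otimes\cdots\otimes v_d)_{[(i)_1,\dots,(i)_d]}=\prod_\kappa (v_\kappa)_{(i)_\kappa}$. "Eigenvalue/eigenvector of a graph" means of its Laplacian. The grid is called simple if all sums $\lambda^1_{i_1}+\dots+\lambda^d_{i_d}$, with $\lambda^\kappa_{i_\kappa}$ ranging over the distinct Laplacian eigenvalues of $P_\kappa$, are pairwise distinct (so every Laplacian eigenvalue of $G$ is simple). Controllability/observability: for a set of nodes $\{i_1,\dots,i_m\}$ of a graph with Laplacian $L$, let $B=[e_{i_1}|\cdots|e_{i_m}]$ and $C=B^T$. The graph is controllable (observable) from this set if the pair $(L,B)$ is controllable (the pair $(L,C)$ is observable). An eigenvalue $\lambda$ of $L$ is uncontrollable (unobservable) from the set if there is an eigenvector of $L$ for $\lambda$ whose components at all nodes $i_1,\dots,i_m$ are zero; such an eigenvector is called uncontrollable (unobservable). Since $L$ is symmetric, the graph is controllable (observable)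 from the set iff no eigenvalue is uncontrollable (unobservable). Eigenvectors are understood up to nonzero scalar multiples. The vectors $V_\nu(n,q)$: let $q\ge 3$ be an odd divisor of $n$ and $m=(q-1)/2$. Let $N_m\in\mathbb R^{m\times m}$ be the tridiagonal matrix with $(1,1)$ entry $1$, all other diagonal entries $2$, and all sub/super-diagonal entries $-1$. For $\nu\in\{1,\dots,m\}$ let $v_\nu\in\mathbb R^m$ be an eigenvector of $N_m$ for the eigenvalue $2-2\cos((2\nu-1)\pi/q)$, and let $\Pi$ be the permutation matrix reversing the components of a vector. Then $$V_\nu(n,q)=\big[v_\nu^T\ \ 0\ \ -(\Pi v_\nu)^T\ \ -v_\nu^T\ \ 0\ \ (\Pi v_\nu)^T\ \cdots\ (-1)^{n/q}(\Pi v_\nu)^T\big]^T\in\mathbb R^n,$$ i.e. the concatenation of the $n/q$ blocks $(-1)^{j-1}[v_\nu^T\ \ 0\ \ -(\Pi v_\nu)^T]^T$, $j=1,\dots,n/q$. *)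

theory Defs
  imports
    Complex_Main
    "HOL-Library.FuncSet"
    "HOL-Number_Theory.Cong"
    "HOL-Computational_Algebra.Primes"
    "Jordan_Normal_Form.Char_Poly"
    "Jordan_Normal_Form.DL_Rank"
begin

section \<open>Graphs and their Laplacians\<close>

text \<open>The nodes come as a list, whose order fixes the row and column order of the
  matrices of the graph.\<close>

record 'a graph =
  nodes :: "'a list"
  adj :: "'a \<Rightarrow> 'a \<Rightarrow> bool"

definition num_nodes :: "'a graph \<Rightarrow> nat" where
  "num_nodes G = length (nodes G)"

definition adjacency_matrix :: "'a graph \<Rightarrow> real mat" where
  "adjacency_matrix G = mat (num_nodes G) (num_nodes G)
     (\<lambda>(a, b). if adj G (nodes G ! a) (nodes G ! b) then 1 else 0)"

definition degree_matrix :: "'a graph \<Rightarrow> real mat" where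
  "degree_matrix G = mat (num_nodes G) (num_nodes G)
     (\<lambda>(a, b). if a = b then real (card {y \<in> set (nodes G). adj G (nodes G ! a) y}) else 0)"

definition laplacian :: "'a graph \<Rightarrow> real mat" where
  "laplacian G = degree_matrix G - adjacency_matrix G"

definition path_graph :: "nat \<Rightarrow> nat graph" where
  "path_graph n = \<lparr> nodes = [1..<Suc n],
     adj = (\<lambda>x y. x \<in> {1..n} \<and> y \<in> {1..n} \<and> (y = x + 1 \<or> x = y + 1)) \<rparr>"

text \<open>The list \<open>product_lists\<close> enumerates the tuples in lexicographic order.\<close>

definition cartesian_product :: "'a graph list \<Rightarrow> 'a list graph" where
  "cartesian_product Gs = \<lparr> nodes = product_lists (map nodes Gs),
     adj = (\<lambda>x y. x \<in> set (product_lists (map nodes Gs)) \<and> y \<in> set (product_lists (map nodes Gs)) \<and>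
       (\<exists>k<length Gs. adj (Gs ! k) (x ! k) (y ! k) \<and>
          (\<forall>l<length Gs. l \<noteq> k \<longrightarrow> x ! l = y ! l))) \<rparr>"

text \<open>Directions are numbered \<open>0, \<dots>, d - 1\<close> (list positions), whereas the coordinates of a
  node range over \<open>1, \<dots>, ns ! l\<close> in direction \<open>l\<close>.\<close>

definition grid_graph :: "nat list \<Rightarrow> nat list graph" where
  "grid_graph ns = cartesian_product (map path_graph ns)"

definition simple_grid :: "nat list \<Rightarrow> bool" where
  "simple_grid ns \<longleftrightarrow>
     inj_on (\<lambda>lam. \<Sum>k<length ns. lam k)
       (PiE {..<length ns} (\<lambda>k. {x. eigenvalue (laplacian (path_graph (ns ! k))) x}))"

text \<open>The vector \<open>u 0 \<otimes> \<dots> \<otimes> u (d - 1)\<close> on the grid; vector entries are numbered from 0,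
  hence the shift by one.\<close>

definition grid_tensor :: "nat list \<Rightarrow> (nat \<Rightarrow> real vec) \<Rightarrow> real vec" where
  "grid_tensor ns u = vec (num_nodes (grid_graph ns))
     (\<lambda>a. \<Prod>k<length ns. u k $ (nodes (grid_graph ns) ! a ! k - 1))"

section \<open>Controllability and observability\<close>

text \<open>Kalman rank conditions: the block matrices \<open>[B, AB, \<dots>, A\<^sup>n\<^sup>-\<^sup>1B]\<close> and
  \<open>[C; CA; \<dots>; CA\<^sup>n\<^sup>-\<^sup>1]\<close> have rank \<open>n\<close>, the order of \<open>A\<close>.\<close>

definition controllability_matrix :: "real mat \<Rightarrow> real mat \<Rightarrow> real mat" where
  "controllability_matrix A B =
     mat_of_cols (dim_row A) (concat (map (\<lambda>k. cols (A ^\<^sub>m k * B)) [0..<dim_row A]))"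

definition observability_matrix :: "real mat \<Rightarrow> real mat \<Rightarrow> real mat" where
  "observability_matrix A C =
     mat_of_rows (dim_row A) (concat (map (\<lambda>k. rows (C * A ^\<^sub>m k)) [0..<dim_row A]))"

definition controllable_pair :: "real mat \<Rightarrow> real mat \<Rightarrow> bool" where
  "controllable_pair A B \<longleftrightarrow>
     vec_space.rank (dim_row A) (controllability_matrix A B) = dim_row A"

definition observable_pair :: "real mat \<Rightarrow> real mat \<Rightarrow> bool" where
  "observable_pair A C \<longleftrightarrow>
     vec_space.rank (dim_row (observability_matrix A C)) (observability_matrix A C) = dim_row A"

definition input_matrix :: "'a graph \<Rightarrow> 'a set \<Rightarrow> real mat" where
  "input_matrix G S = mat_of_cols (num_nodes G)
     (map (unit_vec (num_nodes G)) (filter (\<lambda>a. nodes G ! a \<in> S) [0..<num_nodes G]))"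

definition output_matrix :: "'a graph \<Rightarrow> 'a set \<Rightarrow> real mat" where
  "output_matrix G S = transpose_mat (input_matrix G S)"

definition controllable_from :: "'a graph \<Rightarrow> 'a set \<Rightarrow> bool" where
  "controllable_from G S \<longleftrightarrow> controllable_pair (laplacian G) (input_matrix G S)"

definition observable_from :: "'a graph \<Rightarrow> 'a set \<Rightarrow> bool" where
  "observable_from G S \<longleftrightarrow> observable_pair (laplacian G) (output_matrix G S)"

text \<open>For the symmetric pair \<open>(L, B)\<close>, \<open>(L, B\<^sup>T)\<close> the two notions of uncontrollable and
  unobservable eigenvectors are defined by one and the same condition.\<close>

definition uncontrollable_eigenvector :: "'a graph \<Rightarrow> 'a set \<Rightarrow> real vec \<Rightarrow> real \<Rightarrow> bool" where
  "uncontrollable_eigenvector G S w lam \<longleftrightarrow> eigenvector (laplacian G) w lam \<and>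
     (\<forall>a<num_nodes G. nodes G ! a \<in> S \<longrightarrow> w $ a = 0)"

definition unobservable_eigenvector :: "'a graph \<Rightarrow> 'a set \<Rightarrow> real vec \<Rightarrow> real \<Rightarrow> bool" where
  "unobservable_eigenvector G S w lam \<longleftrightarrow> eigenvector (laplacian G) w lam \<and>
     (\<forall>a<num_nodes G. nodes G ! a \<in> S \<longrightarrow> w $ a = 0)"

definition uncontrollable_eigenvalue :: "'a graph \<Rightarrow> 'a set \<Rightarrow> real \<Rightarrow> bool" where
  "uncontrollable_eigenvalue G S lam \<longleftrightarrow> (\<exists>w. uncontrollable_eigenvector G S w lam)"

definition unobservable_eigenvalue :: "'a graph \<Rightarrow> 'a set \<Rightarrow> real \<Rightarrow> bool" where
  "unobservable_eigenvalue G S lam \<longleftrightarrow> (\<exists>w. unobservable_eigenvector G S w lam)"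

section \<open>The vectors \<open>V\<^sub>\<nu>(n, q)\<close>\<close>

definition N_matrix :: "nat \<Rightarrow> real mat" where
  "N_matrix m = mat m m (\<lambda>(a, b).
     if a = b then (if a = 0 then 1 else 2) else if a = b + 1 \<or> b = a + 1 then -1 else 0)"

definition N_eigenvalue :: "nat \<Rightarrow> nat \<Rightarrow> real" where
  "N_eigenvalue q \<nu> = 2 - 2 * cos ((2 * real \<nu> - 1) * pi / real q)"

definition block_vector :: "nat \<Rightarrow> nat \<Rightarrow> real vec \<Rightarrow> real vec" where
  "block_vector n q v = vec_of_list (concat (map
     (\<lambda>j. map (\<lambda>x. (-1) ^ (j - 1) * x) (list_of_vec v @ [0] @ map uminus (rev (list_of_vec v))))
     [1..<Suc (n div q)]))"

text \<open>Since \<open>v\<^sub>\<nu>\<close> is any eigenvector of \<open>N\<^sub>m\<close> for its eigenvalue, \<open>V\<^sub>\<nu>(n, q)\<close> is only determined up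
  to a nonzero factor and is rendered as a predicate.\<close>

definition is_V :: "nat \<Rightarrow> nat \<Rightarrow> nat \<Rightarrow> real vec \<Rightarrow> bool" where
  "is_V n q \<nu> V \<longleftrightarrow>
     (\<exists>v. eigenvector (N_matrix ((q - 1) div 2)) v (N_eigenvalue q \<nu>) \<and> V = block_vector n q v)"

section \<open>Uncontrollable nodes of grids\<close>

text \<open>The congruence \<open>n - x \<equiv> x - 1\<close> modulo an odd prime factor of \<open>n\<close>; it is only used for
  \<open>1 \<le> x \<le> n\<close>, where the subtractions do not truncate.\<close>

definition symmetric_mod :: "nat \<Rightarrow> nat \<Rightarrow> nat \<Rightarrow> bool" where
  "symmetric_mod n x p \<longleftrightarrow> prime p \<and> odd p \<and> p dvd n \<and> [n - x = x - 1] (mod p)"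

definition block_centres :: "nat \<Rightarrow> nat \<Rightarrow> nat set" where
  "block_centres n q = {h * q - (q - 1) div 2 | h. h \<in> {1..n div q}}"

definition max_exponent :: "nat \<Rightarrow> nat \<Rightarrow> nat \<Rightarrow> nat" where
  "max_exponent n x q = (GREATEST \<alpha>. 1 \<le> \<alpha> \<and> q ^ \<alpha> dvd n \<and> x \<in> block_centres n (q ^ \<alpha>))"

definition centre_nodes :: "nat list \<Rightarrow> nat \<Rightarrow> nat \<Rightarrow> nat list set" where
  "centre_nodes ns l p = {i \<in> set (nodes (grid_graph ns)). i ! l \<in> block_centres (ns ! l) p}"

text \<open>The numbers \<open>x + \<Sum>\<^sub>\<mu> lam \<mu>\<close>, for \<open>x\<close> in \<open>X\<close> and \<open>lam \<mu>\<close> an arbitrary eigenvalue of the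
  path in direction \<open>\<mu> \<noteq> l\<close>.\<close>

definition shifted_eigenvalues :: "nat list \<Rightarrow> nat \<Rightarrow> real set \<Rightarrow> real set" where
  "shifted_eigenvalues ns l X =
     {x + (\<Sum>\<mu>\<in>{..<length ns} - {l}. lam \<mu>) | x lam. x \<in> X \<and>
        (\<forall>\<mu>\<in>{..<length ns} - {l}. eigenvalue (laplacian (path_graph (ns ! \<mu>))) (lam \<mu>))}"

text \<open>\<open>w\<close> is built as \<open>u 0 \<otimes> \<dots> \<otimes> V\<^sub>\<nu>(n\<^sub>l, q) \<otimes> \<dots> \<otimes> u (d - 1)\<close>, with \<open>V\<^sub>\<nu>(n\<^sub>l, q)\<close> in position
  \<open>l\<close>, and \<open>x\<close> is the corresponding sum of eigenvalues.\<close>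

definition built_eigenpair ::
  "nat list \<Rightarrow> nat \<Rightarrow> nat \<Rightarrow> nat \<Rightarrow> real vec \<Rightarrow> real \<Rightarrow> bool" where
  "built_eigenpair ns l q \<nu> w x \<longleftrightarrow>
     (\<exists>u lam V.
        (\<forall>\<mu>\<in>{..<length ns} - {l}. eigenvector (laplacian (path_graph (ns ! \<mu>))) (u \<mu>) (lam \<mu>)) \<and>
        is_V (ns ! l) q \<nu> V \<and>
        w = grid_tensor ns (u(l := V)) \<and>
        x = N_eigenvalue q \<nu> + (\<Sum>\<mu>\<in>{..<length ns} - {l}. lam \<mu>))"

end

theory Submission
  imports Defs
begin

text \<open>The path of length \<open>n\<close> has the eigenvectors \<open>cos ((2x - 1) k \<pi> / 2n)\<close>, \<open>0 \<le> k < n\<close>, with distinct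
  eigenvalues \<open>2 - 2 cos (k \<pi> / n)\<close>. Tensor products of these are eigenvectors of the grid, and in a
  simple grid their eigenvalues are distinct, so that every eigenvector of the grid is a multiple of
  such a tensor product, which vanishes at a node iff one of its factors does. The factor vanishes
  at \<open>x\<close> iff \<open>(2x - 1) k\<close> is an odd multiple of \<open>n\<close>, that is iff \<open>k\<close> is an odd multiple of \<open>n / g\<close> for
  \<open>g = gcd(n, 2x - 1)\<close>. This \<open>g\<close> is the number \<open>Q\<close> of the theorem, because \<open>n - x \<equiv> x - 1 (mod p)\<close> means
  \<open>p | 2x - 1\<close> when \<open>p | n\<close>, and the block centres of block length \<open>q\<close> are the nodes with \<open>q | 2x - 1\<close>.
  For \<open>k = (n / q) (2\<nu> - 1)\<close> the cosine changes sign under reflection inside a block and under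
  translation by \<open>q\<close>, which identifies it with \<open>V\<^sub>\<nu>(n, q)\<close>.\<close>

subsection \<open>Matrices of full rank\<close>

text \<open>Controllability is defined by a rank, whereas the claims are about zeros of
  eigenvectors. The bridge is the Popov-Belevitch-Hautus test, proved for a symmetric matrix with N
  distinct eigenvalues: the Lagrange polynomial of one eigenvalue has degree below N, so the powers
  A^0, ..., A^(N-1) suffice to extract an eigenvector from a vector that violates the rank
  condition. Full row rank of the controllability matrix and full column rank of the observability
  matrix both reduce to one condition on the products of b with A^j w, which is why the two halves
  of the theorem agree. Completeness of the explicit eigenvectors is only a count: they are
  orthogonal, and there are as many as nodes. The numbers 2x - 1 appear because the cosines are
  sampled at the half-integers x - 1/2, which builds in the reflection at the left end. The matrix
  \<open>N_matrix m\<close> is the leading block of a path Laplacian, so its eigenvectors reflect at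
  the left and are forced to vanish just beyond position m - 1; this zero is the centre of a block
  of length q = 2m + 1.\<close>

lemma (in vec_space) rank_eq_dim_row_iff:
  fixes M :: "'a mat"
  assumes M: "M \<in> carrier_mat n nc"
  shows "rank M = n \<longleftrightarrow> span (set (cols M)) = carrier_vec n" (is "?L \<longleftrightarrow> ?R")
proof
  assume ?R
  moreover have eq: "vs (carrier_vec n) = V" using carrier_vs_is_self by simp
  have "vectorspace.dim class_ring (vs (carrier_vec n)) = n" by (subst eq) (rule dim_is_n)
  ultimately show ?L unfolding rank_def by simp
next
  assume L: ?L
  \<comment> \<open>A maximal independent set of columns has \<open>rank M = n\<close> elements and
    is therefore a basis of the whole space.\<close>
  obtain S where S: "maximal S (\<lambda>T. T \<subseteq> set (cols M) \<and> lin_indpt T)"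
    using maximal_exists[of "(\<lambda>T. T \<subseteq> set (cols M) \<and> lin_indpt T)" "card (set (cols M))" "{}"]
    by (meson List.finite_set card_mono empty_iff empty_subsetI finite_lin_indpt2 rev_finite_subset)
  have c: "set (cols M) \<subseteq> carrier_vec n" using M cols_dim by blast
  have "card S = n" using rank_card_indpt[OF M S] L by simp
  moreover have Sc: "S \<subseteq> set (cols M)" "lin_indpt S" using S by (auto simp: maximal_def)
  ultimately have "basis S" using dim_li_is_basis[of S] c dim_is_n fin_dim finite_subset[OF Sc(1)] by auto
  then have "span S = carrier_vec n" by (simp add: basis_def)
  moreover have "span S \<subseteq> span (set (cols M))" using Sc span_is_monotone by blast
  moreover have "span (set (cols M)) \<subseteq> carrier_vec n" using c span_closed by blast
  ultimately show ?R by blast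
qed

text \<open>Independence is a property of the set of columns, so a repeated column is a case of its
  own. There both sides fail: the difference of two unit vectors lies in the kernel, and fewer than
  \<open>nc\<close> different columns bound the rank.\<close>

lemma (in vec_space) rank_eq_dim_col_iff:
  fixes M :: "'a mat"
  assumes M: "M \<in> carrier_mat n nc"
  shows "rank M = nc \<longleftrightarrow> (\<forall>v\<in>carrier_vec nc. M *\<^sub>v v = 0\<^sub>v n \<longrightarrow> v = 0\<^sub>v nc)"
proof (cases "distinct (cols M)")
  case True
  then show ?thesis
    using full_rank_lin_indpt[OF M _ True] lin_indpt_full_rank[OF M True] lin_depI[OF M _ _ _ True]
      lin_depE[OF M _ True] by metis
next
  case False
  then obtain i j where ij: "i \<noteq> j" "i < nc" "j < nc" "col M i = col M j"
    using M unfolding distinct_conv_nth by auto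
  define v where "v = (unit_vec nc i - unit_vec nc j :: 'a vec)"
  have "M *\<^sub>v v = M *\<^sub>v unit_vec nc i - M *\<^sub>v unit_vec nc j"
    unfolding v_def using M by (intro mult_minus_distrib_mat_vec) auto
  also have "\<dots> = col M i - col M j" using M ij by (auto simp: vec_eq_iff)
  also have "\<dots> = 0\<^sub>v n" using ij M by auto
  finally have "M *\<^sub>v v = 0\<^sub>v n" .
  moreover have "v $ i = 1" using ij by (simp add: v_def)
  then have "v \<noteq> 0\<^sub>v nc" using ij by auto
  moreover have "v \<in> carrier_vec nc" by (simp add: v_def)
  moreover have "rank M \<noteq> nc"
  proof -
    obtain S where S: "maximal S (\<lambda>T. T \<subseteq> set (cols M) \<and> lin_indpt T)"
      using maximal_exists[of "(\<lambda>T. T \<subseteq> set (cols M) \<and> lin_indpt T)" "card (set (cols M))" "{}"]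
      by (meson List.finite_set card_mono empty_iff empty_subsetI finite_lin_indpt2 rev_finite_subset)
    have "rank M = card S" by (rule rank_card_indpt[OF M S])
    also have "\<dots> \<le> card (set (cols M))" using S by (auto simp: maximal_def intro: card_mono)
    also have "\<dots> < length (cols M)" using False card_length[of "cols M"] card_distinct[of "cols M"] by linarith
    finally show ?thesis using M by simp
  qed
  ultimately show ?thesis by blast
qed

lemma real_scalar_prod_self_eq_0_iff:
  fixes v :: "real vec"
  assumes "v \<in> carrier_vec n"
  shows "v \<bullet> v = 0 \<longleftrightarrow> v = 0\<^sub>v n"
  using assms unfolding scalar_prod_def by (auto simp: sum_nonneg_eq_0_iff vec_eq_iff)

text \<open>Over the reals a subspace is the whole space as soon as only zero is orthogonal to it.
  In this form the rank condition can be compared with eigenvectors.\<close>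

lemma real_rank_eq_dim_row_iff:
  fixes M :: "real mat"
  assumes M: "M \<in> carrier_mat n nc"
  shows "vec_space.rank n M = n \<longleftrightarrow>
    (\<forall>v\<in>carrier_vec n. (\<forall>c\<in>set (cols M). c \<bullet> v = 0) \<longrightarrow> v = 0\<^sub>v n)" (is "?L \<longleftrightarrow> ?R")
proof -
  interpret vec_space "TYPE(real)" n .
  have tr: "(M\<^sup>T *\<^sub>v v = 0\<^sub>v nc) \<longleftrightarrow> (\<forall>c\<in>set (cols M). c \<bullet> v = 0)" if "v \<in> carrier_vec n" for v
  proof -
    have "(M\<^sup>T *\<^sub>v v = 0\<^sub>v nc) \<longleftrightarrow> (\<forall>i<nc. col M i \<bullet> v = 0)"
      using M that by (auto simp: vec_eq_iff)
    also have "\<dots> \<longleftrightarrow> (\<forall>c\<in>set (cols M). c \<bullet> v = 0)"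
      using M unfolding cols_def by auto
    finally show ?thesis .
  qed
  have col_space: "span (set (cols M)) = {y \<in> carrier_vec n. \<exists>x\<in>carrier_vec nc. M *\<^sub>v x = y}"
    using col_space_eq[OF M] M unfolding col_space_def by auto
  show ?thesis
  proof
    assume ?L
    then have sp: "span (set (cols M)) = carrier_vec n" using rank_eq_dim_row_iff[OF M] by simp
    show ?R
    proof (intro ballI impI)
      fix v :: "real vec" assume v: "v \<in> carrier_vec n" and z: "\<forall>c\<in>set (cols M). c \<bullet> v = 0"
      obtain x where x: "x \<in> carrier_vec nc" "M *\<^sub>v x = v" using sp col_space v by auto
      have "v \<bullet> v = (M\<^sup>T *\<^sub>v v) \<bullet> x"
        using transpose_vec_mult_scalar[OF M x(1) v] x by simp
      also have "\<dots> = 0" using tr[OF v] z x by simp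
      finally show "v = 0\<^sub>v n" using v by (simp add: real_scalar_prod_self_eq_0_iff)
    qed
  next
    assume R: ?R
    \<comment> \<open>The Gram matrix of the rows is invertible, so every \<open>y\<close> is \<open>M (M\<^sup>T S\<^sup>-\<^sup>1 y)\<close>.\<close>
    define S where "S = M * M\<^sup>T"
    have S: "S \<in> carrier_mat n n" using M by (simp add: S_def)
    have "v = 0\<^sub>v n" if v: "v \<in> carrier_vec n" and z: "S *\<^sub>v v = 0\<^sub>v n" for v
    proof -
      have "(M\<^sup>T *\<^sub>v v) \<bullet> (M\<^sup>T *\<^sub>v v) = v \<bullet> (M *\<^sub>v (M\<^sup>T *\<^sub>v v))"
        using transpose_vec_mult_scalar[OF M mult_mat_vec_carrier[OF _ v] v, of "M\<^sup>T"] M by simp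
      also have "M *\<^sub>v (M\<^sup>T *\<^sub>v v) = S *\<^sub>v v" using M v by (simp add: S_def assoc_mult_mat_vec[of _ n nc _ n])
      also have "v \<bullet> \<dots> = 0" using z v by simp
      finally have "M\<^sup>T *\<^sub>v v = 0\<^sub>v nc"
        using real_scalar_prod_self_eq_0_iff[of "M\<^sup>T *\<^sub>v v" nc] M v by simp
      then show ?thesis using tr[OF v] R v by blast
    qed
    then have "det S \<noteq> 0" using det_0_iff_vec_prod_zero[OF S] by blast
    then obtain Y where Y: "Y \<in> carrier_mat n n" "S * Y = 1\<^sub>m n"
      using det_non_zero_imp_unit[OF S] S by (auto simp: Units_def ring_mat_def)
    have "y \<in> span (set (cols M))" if y: "y \<in> carrier_vec n" for y
    proof -
      have "M *\<^sub>v (M\<^sup>T *\<^sub>v (Y *\<^sub>v y)) = S *\<^sub>v (Y *\<^sub>v y)"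
        using M Y y by (simp add: S_def assoc_mult_mat_vec[of _ n nc _ n])
      also have "\<dots> = y" using Y S y by (simp add: assoc_mult_mat_vec[symmetric, of _ n n _ n])
      finally show ?thesis unfolding col_space using M Y y by (auto intro!: bexI[of _ "M\<^sup>T *\<^sub>v (Y *\<^sub>v y)"])
    qed
    moreover have "span (set (cols M)) \<subseteq> carrier_vec n" using col_space by auto
    ultimately show ?L using rank_eq_dim_row_iff[OF M] by blast
  qed
qed

subsection \<open>Symmetric matrices with simple spectrum\<close>

text \<open>The spectral data are given, not derived: \<open>N\<close> eigenvectors with distinct
  eigenvalues. Path and grid both supply explicit ones, indexed by numbers and by functions
  respectively, hence the arbitrary index set \<open>K\<close>.\<close>

locale symmetric_simple_spectrum =
  fixes A :: "real mat" and N :: nat and K :: "'k set" and e :: "'k \<Rightarrow> real vec" and lam :: "'k \<Rightarrow> real"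
  assumes A: "A \<in> carrier_mat N N"
    and sym: "A\<^sup>T = A"
    and finite_K: "finite K"
    and card_K: "card K = N"
    and eigen: "k \<in> K \<Longrightarrow> eigenvector A (e k) (lam k)"
    and inj_lam: "inj_on lam K"
begin

lemma e_carrier: "k \<in> K \<Longrightarrow> e k \<in> carrier_vec N"
  and e_nonzero: "k \<in> K \<Longrightarrow> e k \<noteq> 0\<^sub>v N"
  and mult_e: "k \<in> K \<Longrightarrow> A *\<^sub>v e k = lam k \<cdot>\<^sub>v e k"
  using eigen[of k] A by (auto simp: eigenvector_def)

lemma e_self_nonzero: "k \<in> K \<Longrightarrow> e k \<bullet> e k \<noteq> 0"
  using e_carrier e_nonzero real_scalar_prod_self_eq_0_iff by blast

lemma self_adjoint:
  assumes "v \<in> carrier_vec N" "w \<in> carrier_vec N"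
  shows "(A *\<^sub>v v) \<bullet> w = v \<bullet> (A *\<^sub>v w)"
  using transpose_vec_mult_scalar[OF A assms(2,1)] sym by simp

lemma eigenvector_orthogonal:
  assumes "eigenvector A w x" "k \<in> K" "lam k \<noteq> x"
  shows "e k \<bullet> w = 0"
proof -
  have w: "w \<in> carrier_vec N" "A *\<^sub>v w = x \<cdot>\<^sub>v w" using assms A by (auto simp: eigenvector_def)
  have "lam k * (e k \<bullet> w) = x * (e k \<bullet> w)"
    using self_adjoint[OF e_carrier[OF assms(2)] w(1)] mult_e[OF assms(2)] w e_carrier[OF assms(2)] by simp
  with assms(3) show ?thesis by simp
qed

lemma e_orthogonal: "k \<in> K \<Longrightarrow> l \<in> K \<Longrightarrow> k \<noteq> l \<Longrightarrow> e k \<bullet> e l = 0"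
  using eigenvector_orthogonal[OF eigen, of l k] inj_lam by (auto dest: inj_onD)

text \<open>Completeness of the eigenvectors. With the \<open>e k\<close> as rows of a square matrix
  \<open>P\<close>, orthogonality makes \<open>P * P\<^sup>T\<close> diagonal with nonzero diagonal,
  so \<open>P\<close> has trivial kernel, and \<open>P\<close> maps \<open>v\<close> to
  zero.\<close>

lemma zero_if_orthogonal:
  assumes v: "v \<in> carrier_vec N" and orth: "\<And>k. k \<in> K \<Longrightarrow> e k \<bullet> v = 0"
  shows "v = 0\<^sub>v N"
proof (rule ccontr)
  assume v0: "v \<noteq> 0\<^sub>v N"
  obtain ks where ks: "set ks = K" "distinct ks" using finite_distinct_list[OF finite_K] by blast
  then have len: "length ks = N" using card_K distinct_card by fastforce
  have ksK: "ks ! i \<in> K" if "i < N" for i using that len ks by auto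
  define P where "P = mat_of_rows N (map e ks)"
  have P: "P \<in> carrier_mat N N" unfolding P_def using mat_of_rows_carrier(1)[of N "map e ks"] len by simp
  have row: "row P i = e (ks ! i)" if "i < N" for i
    unfolding P_def using that len e_carrier[OF ksK[OF that]] by (subst mat_of_rows_row) auto
  have "P *\<^sub>v v = 0\<^sub>v N" using P by (auto simp: vec_eq_iff row orth ksK)
  then have "det P = 0" using det_0_iff_vec_prod_zero[OF P] v v0 by blast
  then have "det (P * P\<^sup>T) = 0" using det_mult[of P N "P\<^sup>T"] P by simp
  moreover have entry: "(P * P\<^sup>T) $$ (i, j) = e (ks ! i) \<bullet> e (ks ! j)" if "i < N" "j < N" for i j
    using P that by (simp add: row)
  have "upper_triangular (P * P\<^sup>T)"
    unfolding upper_triangular_def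
  proof (intro allI impI)
    fix i j assume ij: "i < dim_row (P * P\<^sup>T)" "j < i"
    then have "ks ! i \<noteq> ks ! j" using ks len P by (auto simp: nth_eq_iff_index_eq)
    then show "(P * P\<^sup>T) $$ (i, j) = 0" using ij P by (subst entry) (auto intro!: e_orthogonal ksK)
  qed
  then have "det (P * P\<^sup>T) = prod_list (diag_mat (P * P\<^sup>T))"
    using P by (intro det_upper_triangular[of _ N]) auto
  moreover have "prod_list (diag_mat (P * P\<^sup>T)) \<noteq> 0"
    unfolding prod_list_zero_iff diag_mat_def using P entry e_self_nonzero ksK
    by (auto simp del: index_mult_mat(1))
  ultimately show False by simp
qed

lemma multiple_of_e:
  assumes k: "k \<in> K" and v: "v \<in> carrier_vec N" "v \<noteq> 0\<^sub>v N"
    and orth: "\<And>l. l \<in> K \<Longrightarrow> l \<noteq> k \<Longrightarrow> e l \<bullet> v = 0"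
  obtains c where "c \<noteq> 0" "v = c \<cdot>\<^sub>v e k"
proof -
  \<comment> \<open>The coefficient of the orthogonal projection onto \<open>e k\<close>; what
    remains of \<open>v\<close> is orthogonal to all the \<open>e l\<close>.\<close>
  define c where "c = (e k \<bullet> v) / (e k \<bullet> e k)"
  have "v - c \<cdot>\<^sub>v e k = 0\<^sub>v N"
  proof (rule zero_if_orthogonal)
    fix l assume l: "l \<in> K"
    show "e l \<bullet> (v - c \<cdot>\<^sub>v e k) = 0"
      using l k v e_carrier[OF l] e_carrier[OF k] orth[OF l] e_self_nonzero[OF k] e_orthogonal[OF l k]
      by (cases "l = k") (simp_all add: scalar_prod_minus_distrib[of _ N] c_def)
  qed (use v e_carrier[OF k] in auto)
  then have "v $ i = c * e k $ i" if "i < N" for i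
    using that e_carrier[OF k] v by (auto simp: vec_eq_iff)
  then have eq: "v = c \<cdot>\<^sub>v e k" using e_carrier[OF k] v by (auto simp: vec_eq_iff)
  moreover have "c \<noteq> 0" using eq v e_carrier[OF k] by auto
  ultimately show ?thesis using that by blast
qed

text \<open>An eigenvector has a nonzero component along some \<open>e k\<close>. This forces its
  eigenvalue to be \<open>lam k\<close>, and as the other eigenvalues differ, all its other
  components vanish.\<close>

lemma eigenvector_iff:
  "eigenvector A w x \<longleftrightarrow> (\<exists>k\<in>K. \<exists>c. c \<noteq> 0 \<and> w = c \<cdot>\<^sub>v e k \<and> x = lam k)"
proof
  assume w: "eigenvector A w x"
  then have wc: "w \<in> carrier_vec N" "w \<noteq> 0\<^sub>v N" using A by (auto simp: eigenvector_def)
  obtain k where k: "k \<in> K" "e k \<bullet> w \<noteq> 0" using zero_if_orthogonal[OF wc(1)] wc by blast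
  then have x: "x = lam k" using eigenvector_orthogonal[OF w] by blast
  have "e l \<bullet> w = 0" if "l \<in> K" "l \<noteq> k" for l
    using eigenvector_orthogonal[OF w that(1)] inj_lam that k x by (auto dest: inj_onD)
  then show "\<exists>k\<in>K. \<exists>c. c \<noteq> 0 \<and> w = c \<cdot>\<^sub>v e k \<and> x = lam k"
    using multiple_of_e[OF k(1) wc] k x by metis
next
  assume "\<exists>k\<in>K. \<exists>c. c \<noteq> 0 \<and> w = c \<cdot>\<^sub>v e k \<and> x = lam k"
  then obtain k c where k: "k \<in> K" "c \<noteq> 0" "w = c \<cdot>\<^sub>v e k" "x = lam k" by blast
  have "w \<noteq> 0\<^sub>v N" using k e_nonzero[OF k(1)] e_carrier[OF k(1)] by (auto simp: vec_eq_iff)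
  moreover have "A *\<^sub>v w = x \<cdot>\<^sub>v w"
    using k A mult_e[OF k(1)] e_carrier[OF k(1)] by (simp add: mult_mat_vec smult_smult_assoc mult.commute)
  ultimately show "eigenvector A w x"
    using k e_carrier[OF k(1)] A by (auto simp: eigenvector_def)
qed

section \<open>The Kalman rank conditions and the eigenvector test\<close>

lemma self_adjoint_pow:
  assumes "v \<in> carrier_vec N" "w \<in> carrier_vec N"
  shows "(A ^\<^sub>m j *\<^sub>v v) \<bullet> w = v \<bullet> (A ^\<^sub>m j *\<^sub>v w)"
  using assms
proof (induction j arbitrary: v w)
  case 0
  then show ?case using A by simp
next
  case (Suc j)
  have *: "A ^\<^sub>m Suc j *\<^sub>v u = A ^\<^sub>m j *\<^sub>v (A *\<^sub>v u)" if "u \<in> carrier_vec N" for u j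
    using A that by (simp add: assoc_mult_mat_vec[of _ N N _ N])
  \<comment> \<open>Matrix powers unfold with the new factor on the right. The induction moves this
    factor to the other argument, where it arrives on the left, so the two orders must be
    identified.\<close>
  have **: "A ^\<^sub>m Suc j *\<^sub>v u = A *\<^sub>v (A ^\<^sub>m j *\<^sub>v u)" if "u \<in> carrier_vec N" for u
    using that
  proof (induction j arbitrary: u)
    case (Suc j)
    have "A ^\<^sub>m Suc (Suc j) *\<^sub>v u = A ^\<^sub>m Suc j *\<^sub>v (A *\<^sub>v u)" by (rule *[OF Suc.prems])
    also have "\<dots> = A *\<^sub>v (A ^\<^sub>m j *\<^sub>v (A *\<^sub>v u))" using A Suc by auto
    also have "A ^\<^sub>m j *\<^sub>v (A *\<^sub>v u) = A ^\<^sub>m Suc j *\<^sub>v u" by (rule *[OF Suc.prems, symmetric])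
    finally show ?case .
  qed (use A in simp)
  have "(A ^\<^sub>m Suc j *\<^sub>v v) \<bullet> w = (A *\<^sub>v v) \<bullet> (A ^\<^sub>m j *\<^sub>v w)"
    unfolding *[OF Suc.prems(1)] using Suc.prems A by (intro Suc.IH) auto
  also have "\<dots> = v \<bullet> (A *\<^sub>v (A ^\<^sub>m j *\<^sub>v w))"
    using Suc.prems mult_mat_vec_carrier[OF pow_carrier_mat[OF A]] by (intro self_adjoint) auto
  finally show ?case unfolding **[OF Suc.prems(2)] .
qed

text \<open>The Popov-Belevitch-Hautus test. \<open>S\<close> will be the set of columns of the
  input matrix; the powers act on \<open>w\<close> so that one statement serves both rank
  conditions. An eigenvector orthogonal to \<open>S\<close> violates the left side because powers of
  \<open>A\<close> only rescale it.\<close>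

lemma kalman_iff_no_eigenvector:
  assumes N: "N \<noteq> 0" and S: "S \<subseteq> carrier_vec N"
  shows "(\<forall>w\<in>carrier_vec N. (\<forall>b\<in>S. \<forall>j<N. b \<bullet> (A ^\<^sub>m j *\<^sub>v w) = 0) \<longrightarrow> w = 0\<^sub>v N) \<longleftrightarrow>
    \<not> (\<exists>w x. eigenvector A w x \<and> (\<forall>b\<in>S. b \<bullet> w = 0))" (is "?L \<longleftrightarrow> ?R")
proof
  assume L: ?L
  show ?R
  proof (rule notI, elim exE conjE)
    fix w x assume w: "eigenvector A w x" and z: "\<forall>b\<in>S. b \<bullet> w = 0"
    have wc: "w \<in> carrier_vec N" "w \<noteq> 0\<^sub>v N" using w A by (auto simp: eigenvector_def)
    have "b \<bullet> (A ^\<^sub>m j *\<^sub>v w) = 0" if "b \<in> S" for b j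
      using eigenvector_pow[OF A w, of j] z that S wc by auto
    then show False using L wc by blast
  qed
next
  assume R: ?R
  show ?L
  proof (intro ballI impI, rule ccontr)
    fix w assume w: "w \<in> carrier_vec N" "w \<noteq> 0\<^sub>v N" and z: "\<forall>b\<in>S. \<forall>j<N. b \<bullet> (A ^\<^sub>m j *\<^sub>v w) = 0"
    obtain k where k: "k \<in> K" "e k \<bullet> w \<noteq> 0" using zero_if_orthogonal[OF w(1)] w by blast
    \<comment> \<open>The Lagrange polynomial \<open>p\<close> isolates the \<open>k\<close>-th eigencomponent of \<open>w\<close>: \<open>u = p(A) w\<close> is a multiple of \<open>e k\<close>,
      and \<open>degree p < N\<close> makes \<open>b \<bullet> u\<close> a combination of the vanishing products \<open>b \<bullet> A\<^sup>j w\<close>.\<close>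
    define p where "p = (\<Prod>l\<in>K-{k}. [:- lam l, 1:])"
    have "degree p \<le> card (K - {k})"
      unfolding p_def using degree_prod_sum_le[of "K - {k}" "\<lambda>l. [:- lam l, 1:]"] finite_K by simp
    also have "\<dots> < N" using k card_K N by simp
    finally have degree: "degree p < N" .
    define u where "u = vec N (\<lambda>i. \<Sum>j\<le>degree p. coeff p j * (A ^\<^sub>m j *\<^sub>v w) $ i)"
    have u: "u \<in> carrier_vec N" by (simp add: u_def)
    have prod_u: "b \<bullet> u = (\<Sum>j\<le>degree p. coeff p j * (b \<bullet> (A ^\<^sub>m j *\<^sub>v w)))" if "b \<in> carrier_vec N" for b
    proof -
      have "b \<bullet> u = (\<Sum>i<N. \<Sum>j\<le>degree p. coeff p j * (b $ i * (A ^\<^sub>m j *\<^sub>v w) $ i))"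
        by (auto simp: scalar_prod_def u_def sum_distrib_left atLeast0LessThan mult_ac intro!: sum.cong)
      also have "\<dots> = (\<Sum>j\<le>degree p. coeff p j * (b \<bullet> (A ^\<^sub>m j *\<^sub>v w)))"
        using A by (subst sum.swap) (simp add: scalar_prod_def sum_distrib_left atLeast0LessThan)
      finally show ?thesis .
    qed
    \<comment> \<open>Pairing with \<open>e l\<close> replaces \<open>A\<close> by the number
      \<open>lam l\<close>, hence the polynomial in \<open>A\<close> by its value there.\<close>
    have e_u: "e l \<bullet> u = poly p (lam l) * (e l \<bullet> w)" if l: "l \<in> K" for l
    proof -
      have "e l \<bullet> (A ^\<^sub>m j *\<^sub>v w) = lam l ^ j * (e l \<bullet> w)" for j
        using self_adjoint_pow[OF e_carrier[OF l] w(1), of j, symmetric] eigenvector_pow[OF A eigen[OF l], of j]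
          e_carrier[OF l] w by simp
      then show ?thesis
        by (simp add: prod_u[OF e_carrier[OF l]] poly_altdef sum_distrib_left mult_ac)
    qed
    have "poly p (lam l) = 0" if "l \<in> K" "l \<noteq> k" for l
      using that finite_K by (auto simp: p_def poly_prod prod_zero_iff)
    then have orth: "e l \<bullet> u = 0" if "l \<in> K" "l \<noteq> k" for l using e_u that by simp
    have "poly p (lam k) \<noteq> 0"
      using finite_K k inj_lam by (auto simp: p_def poly_prod prod_zero_iff dest: inj_onD)
    then have "e k \<bullet> u \<noteq> 0" using e_u k by simp
    then have "u \<noteq> 0\<^sub>v N" using e_carrier[OF k(1)] by auto
    then obtain c where c: "c \<noteq> 0" "u = c \<cdot>\<^sub>v e k" using multiple_of_e[OF k(1) u _ orth] by blast
    then have "eigenvector A u (lam k)" using eigenvector_iff k by blast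
    moreover have "b \<bullet> u = 0" if "b \<in> S" for b
      using prod_u[of b] that S z degree by (auto intro!: sum.neutral)
    ultimately show False using R by blast
  qed
qed

text \<open>The columns of the controllability matrix are the vectors
  \<open>A ^\<^sub>m j *\<^sub>v b\<close>. Full row rank says that no nonzero \<open>w\<close> is
  orthogonal to all of them, and symmetry moves the powers from \<open>b\<close> to
  \<open>w\<close>.\<close>

lemma controllable_pair_iff:
  assumes N: "N \<noteq> 0" and B: "B \<in> carrier_mat N m"
  shows "controllable_pair A B \<longleftrightarrow> \<not> (\<exists>w x. eigenvector A w x \<and> (\<forall>b\<in>set (cols B). b \<bullet> w = 0))"
proof -
  have Bc: "set (cols B) \<subseteq> carrier_vec N" using B cols_dim by blast
  have cols: "set (cols (A ^\<^sub>m j * B)) = (\<lambda>b. A ^\<^sub>m j *\<^sub>v b) ` set (cols B)" for j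
  proof -
    have "col (A ^\<^sub>m j * B) i = A ^\<^sub>m j *\<^sub>v col B i" if "i < m" for i
      using A B that by (intro col_mult2[of _ N N _ m]) auto
    then show ?thesis unfolding cols_def using B by (auto simp: image_image)
  qed
  define C where "C = concat (map (\<lambda>k. cols (A ^\<^sub>m k * B)) [0..<N])"
  have C: "set C = (\<Union>j<N. (\<lambda>b. A ^\<^sub>m j *\<^sub>v b) ` set (cols B))"
    by (simp add: C_def cols atLeast0LessThan)
  have "set C \<subseteq> carrier_vec N" unfolding C using Bc mult_mat_vec_carrier[OF pow_carrier_mat[OF A]] by auto
  then have colsC: "cols (controllability_matrix A B) = C"
    using A unfolding controllability_matrix_def C_def[symmetric] by (simp add: C_def)
  have "controllability_matrix A B \<in> carrier_mat N (length C)"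
    using A by (simp add: controllability_matrix_def C_def)
  from real_rank_eq_dim_row_iff[OF this]
  have "controllable_pair A B \<longleftrightarrow> (\<forall>w\<in>carrier_vec N. (\<forall>c\<in>set C. c \<bullet> w = 0) \<longrightarrow> w = 0\<^sub>v N)"
    using A by (simp add: controllable_pair_def colsC)
  also have "\<dots> \<longleftrightarrow> (\<forall>w\<in>carrier_vec N. (\<forall>b\<in>set (cols B). \<forall>j<N. b \<bullet> (A ^\<^sub>m j *\<^sub>v w) = 0) \<longrightarrow> w = 0\<^sub>v N)"
    
  proof (rule ball_cong[OF refl])
    fix w :: "real vec" assume w: "w \<in> carrier_vec N"
    have "(A ^\<^sub>m j *\<^sub>v b) \<bullet> w = b \<bullet> (A ^\<^sub>m j *\<^sub>v w)" if "b \<in> set (cols B)" for b j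
      using self_adjoint_pow[OF _ w] Bc that by blast
    then have "(\<forall>c\<in>set C. c \<bullet> w = 0) \<longleftrightarrow>
        (\<forall>b\<in>set (cols B). \<forall>j<N. b \<bullet> (A ^\<^sub>m j *\<^sub>v w) = 0)"
      unfolding C by auto
    then show "((\<forall>c\<in>set C. c \<bullet> w = 0) \<longrightarrow> w = 0\<^sub>v N) \<longleftrightarrow>
        ((\<forall>b\<in>set (cols B). \<forall>j<N. b \<bullet> (A ^\<^sub>m j *\<^sub>v w) = 0) \<longrightarrow> w = 0\<^sub>v N)" by simp
  qed
  finally show ?thesis using kalman_iff_no_eigenvector[OF N Bc] by blast
qed

text \<open>Here the rank condition is a trivial kernel. A row of
  \<open>B\<^sup>T * A ^\<^sub>m j\<close> applied to \<open>w\<close> is by associativity the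
  product of a column of \<open>B\<close> with \<open>A ^\<^sub>m j *\<^sub>v w\<close>, the same
  quantity as for controllability.\<close>

lemma observable_pair_iff:
  assumes N: "N \<noteq> 0" and B: "B \<in> carrier_mat N m"
  shows "observable_pair A B\<^sup>T \<longleftrightarrow> \<not> (\<exists>w x. eigenvector A w x \<and> (\<forall>b\<in>set (cols B). b \<bullet> w = 0))"
proof -
  have Bc: "set (cols B) \<subseteq> carrier_vec N" using B cols_dim by blast
  define C where "C = concat (map (\<lambda>k. rows (B\<^sup>T * A ^\<^sub>m k)) [0..<N])"
  have Cc: "set C \<subseteq> carrier_vec N" 
    unfolding C_def using A B by (auto simp: rows_def)
  define Ob where "Ob = observability_matrix A B\<^sup>T"
  have Ob: "Ob \<in> carrier_mat (length C) N" and rows_Ob: "rows Ob = C"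
    using A Cc unfolding Ob_def observability_matrix_def by (auto simp: C_def)
  have "observable_pair A B\<^sup>T \<longleftrightarrow> vec_space.rank (length C) Ob = N"
    using A Ob unfolding observable_pair_def Ob_def[symmetric] by simp
  also have "\<dots> \<longleftrightarrow> (\<forall>w\<in>carrier_vec N. Ob *\<^sub>v w = 0\<^sub>v (length C) \<longrightarrow> w = 0\<^sub>v N)"
    by (rule vec_space.rank_eq_dim_col_iff[OF Ob])
  also have "\<dots> \<longleftrightarrow> (\<forall>w\<in>carrier_vec N. (\<forall>b\<in>set (cols B). \<forall>j<N. b \<bullet> (A ^\<^sub>m j *\<^sub>v w) = 0) \<longrightarrow> w = 0\<^sub>v N)"
  proof (rule ball_cong[OF refl])
    fix w :: "real vec" assume w: "w \<in> carrier_vec N"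
    have row: "row (B\<^sup>T * A ^\<^sub>m j) i \<bullet> w = col B i \<bullet> (A ^\<^sub>m j *\<^sub>v w)" if "i < m" for i j
    proof -
      have "row (B\<^sup>T * A ^\<^sub>m j) i \<bullet> w = ((B\<^sup>T * A ^\<^sub>m j) *\<^sub>v w) $ i" using A B that by simp
      also have "(B\<^sup>T * A ^\<^sub>m j) *\<^sub>v w = B\<^sup>T *\<^sub>v (A ^\<^sub>m j *\<^sub>v w)"
        using A B w by (intro assoc_mult_mat_vec[of _ m N _ N]) auto
      finally show ?thesis using A B that by simp
    qed
    have "Ob *\<^sub>v w = 0\<^sub>v (length C) \<longleftrightarrow> (\<forall>i<length C. row Ob i \<bullet> w = 0)"
      using Ob by (auto simp: vec_eq_iff)
    also have "\<dots> \<longleftrightarrow> (\<forall>c\<in>set (rows Ob). c \<bullet> w = 0)"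
      using Ob unfolding rows_def by auto
    also have "\<dots> \<longleftrightarrow> (\<forall>j<N. \<forall>i<m. row (B\<^sup>T * A ^\<^sub>m j) i \<bullet> w = 0)"
      unfolding rows_Ob C_def using B by (auto simp: rows_def)
    also have "\<dots> \<longleftrightarrow> (\<forall>b\<in>set (cols B). \<forall>j<N. b \<bullet> (A ^\<^sub>m j *\<^sub>v w) = 0)"
      using B by (auto simp: row cols_def)
    finally show "(Ob *\<^sub>v w = 0\<^sub>v (length C) \<longrightarrow> w = 0\<^sub>v N) \<longleftrightarrow>
        ((\<forall>b\<in>set (cols B). \<forall>j<N. b \<bullet> (A ^\<^sub>m j *\<^sub>v w) = 0) \<longrightarrow> w = 0\<^sub>v N)" by simp
  qed
  finally show ?thesis using kalman_iff_no_eigenvector[OF N Bc] by blast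
qed

end

subsection \<open>The spectrum of the path\<close>

lemma laplacian_carrier [simp]: "laplacian G \<in> carrier_mat (num_nodes G) (num_nodes G)"
  and dim_row_laplacian [simp]: "dim_row (laplacian G) = num_nodes G"
  and dim_col_laplacian [simp]: "dim_col (laplacian G) = num_nodes G"
  by (auto simp: laplacian_def degree_matrix_def adjacency_matrix_def)

lemma transpose_laplacian:
  assumes "\<And>x y. adj G x y \<longleftrightarrow> adj G y x"
  shows "(laplacian G)\<^sup>T = laplacian G"
  using assms by (auto simp: laplacian_def degree_matrix_def adjacency_matrix_def)

text \<open>The degree counts the neighbouring positions, since distinct positions carry distinct
  nodes. The diagonal term thus splits into one copy of \<open>v $ a\<close> for each
  neighbour.\<close>

lemma laplacian_mult_vec:
  assumes G: "distinct (nodes G)" and a: "a < num_nodes G" and v: "v \<in> carrier_vec (num_nodes G)"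
  shows "(laplacian G *\<^sub>v v) $ a =
    (\<Sum>b | b < num_nodes G \<and> adj G (nodes G ! a) (nodes G ! b). v $ a - v $ b)"
proof -
  define I where "I = {b. b < num_nodes G \<and> adj G (nodes G ! a) (nodes G ! b)}"
  have "{y \<in> set (nodes G). adj G (nodes G ! a) y} = (!) (nodes G) ` I"
    by (auto simp: I_def num_nodes_def in_set_conv_nth)
  moreover have "inj_on ((!) (nodes G)) I"
    using G by (auto simp: I_def num_nodes_def inj_on_def nth_eq_iff_index_eq)
  ultimately have deg: "card {y \<in> set (nodes G). adj G (nodes G ! a) y} = card I"
    by (simp add: card_image)
  have entry: "laplacian G $$ (a, b) = (if a = b then real (card I) else 0) - (if b \<in> I then 1 else 0)"
    if "b < num_nodes G" for b
    using that a deg by (auto simp: laplacian_def degree_matrix_def adjacency_matrix_def I_def)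
  have "(laplacian G *\<^sub>v v) $ a = (\<Sum>b<num_nodes G. laplacian G $$ (a, b) * v $ b)"
    using a v by (auto simp: scalar_prod_def atLeast0LessThan intro!: sum.cong)
  also have "\<dots> = (\<Sum>b<num_nodes G. (if a = b then real (card I) * v $ b else 0) - (if b \<in> I then v $ b else 0))"
    by (intro sum.cong) (auto simp: entry algebra_simps)
  also have "\<dots> = real (card I) * v $ a - (\<Sum>b<num_nodes G. if b \<in> I then v $ b else 0)"
    using a by (simp add: sum_subtractf)
  also have "(\<Sum>b<num_nodes G. if b \<in> I then v $ b else 0) = (\<Sum>b\<in>{..<num_nodes G} \<inter> I. v $ b)"
    by (simp add: sum.inter_restrict)
  also have "{..<num_nodes G} \<inter> I = I" by (auto simp: I_def)
  finally show ?thesis by (simp add: sum_subtractf I_def)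
qed

text \<open>A cosine of frequency \<open>\<theta>\<close> sampled at \<open>a + 1/2\<close>. With
  \<open>a = x - 1\<close> for node \<open>x\<close>, the factor \<open>2 * a + 1\<close> is
  \<open>2 * x - 1\<close>.\<close>

definition half_cos :: "real \<Rightarrow> nat \<Rightarrow> real" where
  "half_cos \<theta> a = cos ((2 * real a + 1) * \<theta> / 2)"

text \<open>Position -1 would have the argument \<open>- \<theta> / 2\<close> and so, by evenness,
  the value of position 0: in the second difference at 0 the left term drops out.\<close>

lemma half_cos_0: "half_cos \<theta> 0 - half_cos \<theta> 1 = (2 - 2 * cos \<theta>) * half_cos \<theta> 0"
  using cos_add[of "\<theta> / 2" \<theta>] cos_diff[of "\<theta> / 2" \<theta>] cos_minus[of "\<theta> / 2"]
  by (simp add: half_cos_def algebra_simps)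

lemma half_cos_Suc:
  "2 * half_cos \<theta> (Suc a) - half_cos \<theta> a - half_cos \<theta> (Suc (Suc a)) = (2 - 2 * cos \<theta>) * half_cos \<theta> (Suc a)"
proof -
  \<comment> \<open>The argument at the middle position; its neighbours lie at distance
    \<open>\<theta>\<close> on either side.\<close>
  define x where "x = (2 * real a + 3) * \<theta> / 2"
  have "half_cos \<theta> (Suc a) = cos x" "half_cos \<theta> a = cos (x - \<theta>)" "half_cos \<theta> (Suc (Suc a)) = cos (x + \<theta>)"
    by (simp_all add: half_cos_def x_def field_simps)
  then show ?thesis by (simp add: cos_add cos_diff algebra_simps)
qed

text \<open>The unnormalised basis of the discrete cosine transform of type II. The frequency makes
  the samples symmetric about the right end as well.\<close>

definition path_mode :: "nat \<Rightarrow> nat \<Rightarrow> real vec" where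
  "path_mode n k = vec n (half_cos (real k * pi / real n))"

definition path_eigenvalue :: "nat \<Rightarrow> nat \<Rightarrow> real" where
  "path_eigenvalue n k = 2 - 2 * cos (real k * pi / real n)"

lemma path_mode_carrier [simp]: "path_mode n k \<in> carrier_vec n" "dim_vec (path_mode n k) = n"
  by (simp_all add: path_mode_def)

lemma nodes_path_graph: "nodes (path_graph n) = [1..<Suc n]"
  by (simp add: path_graph_def)

lemma num_nodes_path_graph [simp]: "num_nodes (path_graph n) = n"
  by (simp add: num_nodes_def nodes_path_graph)

lemma nth_nodes_path_graph: "a < n \<Longrightarrow> nodes (path_graph n) ! a = Suc a"
  by (simp add: nodes_path_graph del: upt_Suc)

lemma laplacian_path_mult_vec:
  assumes "a < n" "v \<in> carrier_vec n"
  shows "(laplacian (path_graph n) *\<^sub>v v) $ a =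
    (if Suc a < n then v $ a - v $ Suc a else 0) + (if a = 0 then 0 else v $ a - v $ (a - 1))"
proof -
  have "{b. b < n \<and> adj (path_graph n) (Suc a) (nodes (path_graph n) ! b)} =
      (if Suc a < n then {Suc a} else {}) \<union> (if a = 0 then {} else {a - 1})"
    using assms(1) by (auto simp: path_graph_def simp del: upt_Suc)
  then show ?thesis
    using assms laplacian_mult_vec[of "path_graph n" a v]
    by (auto simp: nth_nodes_path_graph nodes_path_graph simp del: upt_Suc)
qed

text \<open>The argument \<open>k * pi / (2 * n)\<close> lies in \<open>[0, pi / 2)\<close>. Besides
  showing that modes are nonzero, this later silences a direction of the grid by setting its
  coordinate to 1.\<close>

lemma path_mode_nonzero_first: "k < n \<Longrightarrow> path_mode n k $ 0 \<noteq> 0"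
proof -
  assume k: "k < n"
  then have "real k * pi / real n / 2 < pi / 2" by (simp add: field_simps)
  moreover have "0 \<le> real k * pi / real n / 2" by simp
  ultimately have "cos (real k * pi / real n / 2) > 0" by (intro cos_gt_zero_pi) (use pi_gt_zero in linarith)+
  then show ?thesis using k by (simp add: path_mode_def half_cos_def)
qed

lemma path_mode_eigenvector:
  assumes "k < n"
  shows "eigenvector (laplacian (path_graph n)) (path_mode n k) (path_eigenvalue n k)"
proof -
  define \<theta> where "\<theta> = real k * pi / real n"
  have mode: "path_mode n k $ a = half_cos \<theta> a" if "a < n" for a
    using that by (simp add: path_mode_def \<theta>_def)
  obtain n' where n': "n = Suc n'" using assms by (cases n) auto
  \<comment> \<open>reflection at the right end, which turns the boundary row into an interior one\<close>
  have refl: "half_cos \<theta> n = half_cos \<theta> n'"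
  proof -
    have "real n * \<theta> = real k * pi" using assms by (simp add: \<theta>_def)
    moreover have "half_cos \<theta> n = cos (real n * \<theta> + \<theta> / 2)"
      by (simp add: half_cos_def distrib_right add_divide_distrib)
    moreover have "half_cos \<theta> n' = cos (real n * \<theta> - \<theta> / 2)"
    proof -
      have "(2 * real n' + 1) * \<theta> / 2 = real n * \<theta> - \<theta> / 2" unfolding n' by (simp add: field_simps)
      then show ?thesis by (simp only: half_cos_def)
    qed
    ultimately show ?thesis by (simp add: cos_add cos_diff)
  qed
  have "(laplacian (path_graph n) *\<^sub>v path_mode n k) $ a = path_eigenvalue n k * path_mode n k $ a" if a: "a < n" for a
  proof -
    \<comment> \<open>In the last row the difference to the right is zero by \<open>refl\<close>, so
      one formula covers all rows.\<close>
    have right: "(if Suc a < n then path_mode n k $ a - path_mode n k $ Suc a else 0) = half_cos \<theta> a - half_cos \<theta> (Suc a)"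
    proof (cases "Suc a < n")
      case False
      then have "Suc a = n" "a = n'" using a n' by auto
      then show ?thesis using refl by simp
    qed (simp add: mode)
    have left: "(if a = 0 then 0 else path_mode n k $ a - path_mode n k $ (a - 1)) =
        (if a = 0 then 0 else half_cos \<theta> a - half_cos \<theta> (a - 1))"
      using a by (simp add: mode)
    show ?thesis
      using half_cos_0[of \<theta>] half_cos_Suc[of \<theta> "a - 1"] a
      unfolding laplacian_path_mult_vec[OF a path_mode_carrier(1)] right left
      by (cases a) (simp_all add: mode path_eigenvalue_def \<theta>_def[symmetric])
  qed
  moreover have "path_mode n k \<noteq> 0\<^sub>v n" using path_mode_nonzero_first[OF assms] assms by auto
  ultimately show ?thesis by (auto simp: eigenvector_def vec_eq_iff)
qed

lemma path_eigenvalue_inj: "inj_on (path_eigenvalue n) {..<n}"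
proof (rule inj_onI)
  fix k l assume kl: "k \<in> {..<n}" "l \<in> {..<n}" and eq: "path_eigenvalue n k = path_eigenvalue n l"
  have "real j * pi / real n \<le> pi" if "j < n" for j using that by (simp add: divide_le_eq)
  then have bounds: "real k * pi / real n \<le> pi" "real l * pi / real n \<le> pi" using kl by auto
  have "cos (real k * pi / real n) = cos (real l * pi / real n)" using eq by (simp add: path_eigenvalue_def)
  then have "real k * pi / real n = real l * pi / real n" by (rule cos_inj_pi[rotated -1]) (use bounds in auto)
  then show "k = l" using kl(1) by simp
qed

lemma path_spectrum:
  "symmetric_simple_spectrum (laplacian (path_graph n)) n {..<n} (path_mode n) (path_eigenvalue n)"
proof
  show "laplacian (path_graph n) \<in> carrier_mat n n" using laplacian_carrier[of "path_graph n"] by simp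
  show "(laplacian (path_graph n))\<^sup>T = laplacian (path_graph n)"
    by (rule transpose_laplacian) (auto simp: path_graph_def)
qed (auto simp: path_mode_eigenvector path_eigenvalue_inj)

lemmas path_eigenvector_iff = symmetric_simple_spectrum.eigenvector_iff[OF path_spectrum]

lemma path_eigenvalue_iff: "eigenvalue (laplacian (path_graph n)) x \<longleftrightarrow> (\<exists>k<n. x = path_eigenvalue n k)"
proof
  assume "eigenvalue (laplacian (path_graph n)) x"
  then obtain v where "eigenvector (laplacian (path_graph n)) v x" unfolding eigenvalue_def ..
  then show "\<exists>k<n. x = path_eigenvalue n k" unfolding path_eigenvector_iff by auto
next
  assume "\<exists>k<n. x = path_eigenvalue n k"
  then obtain k where "k < n" "x = path_eigenvalue n k" by blast
  then have "eigenvector (laplacian (path_graph n)) (path_mode n k) x" using path_mode_eigenvector by simp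
  then show "eigenvalue (laplacian (path_graph n)) x" unfolding eigenvalue_def ..
qed

section \<open>Zeros of the path modes\<close>

lemma half_cos_eq_0_iff:
  assumes "n > 0"
  shows "half_cos (real k * pi / real n) a = 0 \<longleftrightarrow> (\<exists>t. odd t \<and> (2 * a + 1) * k = n * t)"
proof -
  have "half_cos (real k * pi / real n) a = 0 \<longleftrightarrow>
      (\<exists>i::int. odd i \<and> real ((2 * a + 1) * k) / real n * (pi / 2) = of_int i * (pi / 2))"
  proof -
    have "(2 * real a + 1) * (real k * pi / real n) / 2 = real ((2 * a + 1) * k) / real n * (pi / 2)"
      using assms by (simp add: field_simps)
    then show ?thesis unfolding half_cos_def cos_zero_iff_int by (simp only:)
  qed
  also have "\<dots> \<longleftrightarrow> (\<exists>i::int. odd i \<and> real ((2 * a + 1) * k) = real n * of_int i)"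
  proof -
    have "real ((2 * a + 1) * k) / real n * (pi / 2) = of_int i * (pi / 2) \<longleftrightarrow>
        real ((2 * a + 1) * k) = real n * of_int i" for i :: int
      using assms by (simp only: mult_cancel_right) (simp add: divide_eq_eq mult.commute)
    then show ?thesis by simp
  qed
  also have "\<dots> \<longleftrightarrow> (\<exists>i::int. odd i \<and> int ((2 * a + 1) * k) = int n * i)"
  proof -
    have "real ((2 * a + 1) * k) = real n * of_int i \<longleftrightarrow> int ((2 * a + 1) * k) = int n * i" for i
    proof -
      have "real ((2 * a + 1) * k) = of_int (int ((2 * a + 1) * k))" "real n * of_int i = of_int (int n * i)"
        by simp_all
      then show ?thesis by (simp only: of_int_eq_iff)
    qed
    then show ?thesis by (simp only:)
  qed
  also have "\<dots> \<longleftrightarrow> (\<exists>t. odd t \<and> (2 * a + 1) * k = n * t)"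
  proof
    assume "\<exists>i::int. odd i \<and> int ((2 * a + 1) * k) = int n * i"
    then obtain i where i: "odd i" "int ((2 * a + 1) * k) = int n * i" by blast
    \<comment> \<open>A zero of the cosine gives an odd integer; the sign of the product makes it a
      natural number.\<close>
    have "0 \<le> int n * i" unfolding i(2)[symmetric] by simp
    then have "i \<ge> 0" using assms by (simp add: zero_le_mult_iff)
    then have "odd (nat i)" using i by (simp add: even_nat_iff)
    moreover have "int ((2 * a + 1) * k) = int (n * nat i)" using i \<open>i \<ge> 0\<close> by simp
    then have "(2 * a + 1) * k = n * nat i" by (simp only: of_nat_eq_iff)
    ultimately show "\<exists>t. odd t \<and> (2 * a + 1) * k = n * t" by (intro exI[of _ "nat i"] conjI)
  next
    assume "\<exists>t. odd t \<and> (2 * a + 1) * k = n * t"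
    then obtain t where "odd t" "(2 * a + 1) * k = n * t" by blast
    then have "odd (int t)" "int ((2 * a + 1) * k) = int n * int t" by (simp, metis of_nat_mult)
    then show "\<exists>i::int. odd i \<and> int ((2 * a + 1) * k) = int n * i" by blast
  qed
  finally show ?thesis .
qed

lemma odd_two_mult_minus_1: "x \<ge> 1 \<Longrightarrow> odd (2 * x - 1 :: nat)"
  by simp

text \<open>Vector entries are numbered from 0, so \<open>x - 1\<close> is the position of node \<open>x\<close>.\<close>

lemma path_mode_eq_0_iff:
  fixes n x k :: nat
  assumes x: "x \<in> {1..n}" and k: "k < n"
  defines "g \<equiv> gcd n (2 * x - 1)"
  shows "path_mode n k $ (x - 1) = 0 \<longleftrightarrow> (\<exists>\<nu>\<in>{1..(g - 1) div 2}. k = n div g * (2 * \<nu> - 1))"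
proof -
  define n' y where "n' = n div g" and "y = (2 * x - 1) div g"
  have pos: "g > 0" "n > 0" using k by (auto simp: g_def)
  have n: "n = n' * g" and y: "2 * x - 1 = y * g" by (auto simp: n'_def y_def g_def)
  have cop: "coprime n' y" unfolding n'_def y_def g_def using div_gcd_coprime[of n "2 * x - 1"] k by simp
  have "odd (y * g)" using x y odd_two_mult_minus_1[of x] by simp
  then have odd_y: "odd y" "odd g" by auto
  have "n' > 0" using n pos by (cases n') auto
  have "path_mode n k $ (x - 1) = 0 \<longleftrightarrow> (\<exists>t. odd t \<and> (2 * x - 1) * k = n * t)"
  proof -
    have "2 * (x - 1) + 1 = 2 * x - 1" "x - 1 < n" using x by auto
    then show ?thesis using half_cos_eq_0_iff[OF pos(2), of k "x - 1"] by (simp add: path_mode_def)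
  qed
  also have "\<dots> \<longleftrightarrow> (\<exists>t. odd t \<and> y * k = n' * t)"
    
  proof -
    have "(y * g) * k = (n' * g) * t \<longleftrightarrow> y * k = n' * t" for t
      using pos by (simp add: mult_ac)
    then show ?thesis unfolding y n[symmetric] by simp
  qed
  also have "\<dots> \<longleftrightarrow> (\<exists>s. odd s \<and> k = n' * s)"
  proof
    assume "\<exists>t. odd t \<and> y * k = n' * t"
    then obtain t where t: "odd t" "y * k = n' * t" by blast
    then have "n' dvd y * k" by (metis dvd_triv_left)
    then have "n' dvd k" using cop coprime_dvd_mult_right_iff by blast
    then obtain s where s: "k = n' * s" by blast
    then have "y * s = t" using t \<open>n' > 0\<close> by (simp add: mult.left_commute)
    then show "\<exists>s. odd s \<and> k = n' * s" using s t(1) by (intro exI[of _ s]) auto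
  next
    assume "\<exists>s. odd s \<and> k = n' * s"
    then obtain s where "odd s" "k = n' * s" by blast
    then show "\<exists>t. odd t \<and> y * k = n' * t" using odd_y by (intro exI[of _ "y * s"]) (auto simp: mult_ac)
  qed
  also have "\<dots> \<longleftrightarrow> (\<exists>\<nu>\<in>{1..(g - 1) div 2}. k = n' * (2 * \<nu> - 1))"
  proof
    assume "\<exists>s. odd s \<and> k = n' * s"
    then obtain s where s: "odd s" "k = n' * s" by blast
    \<comment> \<open>The bound \<open>k < n\<close> is what limits \<open>\<nu>\<close>: an odd
      \<open>s\<close> below the odd number \<open>g\<close> is \<open>2 * \<nu> - 1\<close> with
      \<open>\<nu> \<le> (g - 1) div 2\<close>.\<close>
    have "n' * s < n' * g" using k unfolding s(2) n[symmetric] .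
    then have "s < g" by simp
    obtain u where u: "s = 2 * u + 1" using s by (elim oddE)
    obtain h where h: "g = 2 * h + 1" using odd_y by (elim oddE)
    have "Suc u \<in> {1..(g - 1) div 2}" using u h \<open>s < g\<close> by auto
    then show "\<exists>\<nu>\<in>{1..(g - 1) div 2}. k = n' * (2 * \<nu> - 1)" using s u by (intro bexI[of _ "Suc u"]) auto
  next
    assume "\<exists>\<nu>\<in>{1..(g - 1) div 2}. k = n' * (2 * \<nu> - 1)"
    then obtain \<nu> where "\<nu> \<in> {1..(g - 1) div 2}" "k = n' * (2 * \<nu> - 1)" by blast
    then show "\<exists>s. odd s \<and> k = n' * s" by (intro exI[of _ "2 * \<nu> - 1"]) auto
  qed
  finally show ?thesis by (simp add: n'_def)
qed

subsection \<open>The vectors \<open>V\<^sub>\<nu>(n, q)\<close>\<close>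

lemma N_eigenvalue_eq_path_eigenvalue:
  assumes "q dvd n" "n > 0" "\<nu> \<ge> 1"
  shows "path_eigenvalue n (n div q * (2 * \<nu> - 1)) = N_eigenvalue q \<nu>"
proof -
  have "real (n div q * (2 * \<nu> - 1)) = real n / real q * (2 * real \<nu> - 1)"
    using assms by (simp add: of_nat_diff real_of_nat_div)
  then show ?thesis using assms(2) by (simp add: path_eigenvalue_def N_eigenvalue_def)
qed

lemma N_matrix_mult_vec:
  assumes "a < m" "v \<in> carrier_vec m"
  shows "(N_matrix m *\<^sub>v v) $ a =
    (if a = 0 then v $ 0 else 2 * v $ a - v $ (a - 1)) - (if Suc a < m then v $ Suc a else 0)"
proof -
  have "(N_matrix m *\<^sub>v v) $ a = (\<Sum>b<m. N_matrix m $$ (a, b) * v $ b)"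
    using assms by (auto simp: N_matrix_def scalar_prod_def atLeast0LessThan intro!: sum.cong)
  \<comment> \<open>At \<open>a = 0\<close> the truncated \<open>a - 1\<close> is again 0, so that
    term is guarded separately. In the last row \<open>b = Suc a\<close> is outside the range and
    contributes nothing.\<close>
  also have "\<dots> = (\<Sum>b<m. (if b = a then (if a = 0 then v $ 0 else 2 * v $ a) else 0)
      - (if b = a - 1 then if a = 0 then 0 else v $ (a - 1) else 0) - (if b = Suc a then v $ Suc a else 0))"
    using assms by (intro sum.cong) (auto simp: N_matrix_def)
  also have "\<dots> = (if a = 0 then v $ 0 else 2 * v $ a - v $ (a - 1)) - (if Suc a < m then v $ Suc a else 0)"
    using assms by (auto simp: sum_subtractf)
  finally show ?thesis .
qed

text \<open>The half cosine satisfies the interior rows and the first row for every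
  \<open>\<theta>\<close>; the last row holds because it vanishes at position \<open>m\<close>, its
  argument there being \<open>q * \<theta> / 2\<close>, an odd multiple of \<open>pi / 2\<close>.
  Conversely the rows form a three-term recurrence, so an eigenvector is determined by its first
  entry.\<close>

lemma N_matrix_eigenvector_iff:
  fixes q \<nu> :: nat
  assumes q: "odd q" and \<nu>: "\<nu> \<in> {1..(q - 1) div 2}"
  defines "m \<equiv> (q - 1) div 2" and "\<theta> \<equiv> (2 * real \<nu> - 1) * pi / real q"
  shows "eigenvector (N_matrix m) v (N_eigenvalue q \<nu>) \<longleftrightarrow> (\<exists>c. c \<noteq> 0 \<and> v = c \<cdot>\<^sub>v vec m (half_cos \<theta>))"
proof -
  have m: "q = 2 * m + 1" "m > 0" using q \<nu> by (auto simp: m_def elim: oddE)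
  have dim: "dim_row (N_matrix m) = m" by (simp add: N_matrix_def)
  have ev: "N_eigenvalue q \<nu> = 2 - 2 * cos \<theta>" by (simp add: N_eigenvalue_def \<theta>_def)
  have "half_cos \<theta> m = cos (real (2 * \<nu> - 1) * (pi / 2))"
    using \<nu> m by (auto simp: half_cos_def \<theta>_def of_nat_diff field_simps intro!: arg_cong[of _ _ cos])
  also have "\<dots> = 0" using \<nu> unfolding cos_zero_iff by (intro disjI1 exI[of _ "2 * \<nu> - 1"]) auto
  finally have zero: "half_cos \<theta> m = 0" .
  have "real \<nu> \<le> real m" using \<nu> by (simp add: m_def)
  then have "\<theta> \<ge> 0" "\<theta> < pi" using \<nu> m by (auto simp: \<theta>_def pos_divide_less_eq)
  then have "half_cos \<theta> 0 > 0"
    unfolding half_cos_def by (intro cos_gt_zero_pi) auto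
  then have first: "half_cos \<theta> 0 \<noteq> 0" by simp
  show ?thesis
  proof
    assume "eigenvector (N_matrix m) v (N_eigenvalue q \<nu>)"
    then have v: "v \<in> carrier_vec m" "v \<noteq> 0\<^sub>v m" "N_matrix m *\<^sub>v v = (2 - 2 * cos \<theta>) \<cdot>\<^sub>v v"
      by (auto simp: eigenvector_def dim ev)
    have eq: "(if a = 0 then v $ 0 else 2 * v $ a - v $ (a - 1)) - v $ Suc a = (2 - 2 * cos \<theta>) * v $ a"
      if "Suc a < m" for a
      using N_matrix_mult_vec[OF _ v(1), of a] v that by simp
    \<comment> \<open>Matching the first entries fixes the factor, since
      \<open>half_cos \<theta> 0\<close> is positive.\<close>
    define c where "c = v $ 0 / half_cos \<theta> 0"
    have "v $ a = c * half_cos \<theta> a" if "a < m" for a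
      using that
    proof (induction a rule: less_induct)
      case (less a)
      consider "a = 0" | "a = 1" | b where "a = Suc (Suc b)" by (metis One_nat_def not0_implies_Suc)
      then show ?case
      proof cases
        case 1
        then show ?thesis using first by (simp add: c_def)
      next
        case 2
        have "v $ 1 = v $ 0 - (2 - 2 * cos \<theta>) * v $ 0" using eq[of 0] 2 less.prems by simp
        also have "v $ 0 = c * half_cos \<theta> 0" using first by (simp add: c_def)
        also have "c * half_cos \<theta> 0 - (2 - 2 * cos \<theta>) * (c * half_cos \<theta> 0) = c * half_cos \<theta> 1"
          using arg_cong[OF half_cos_0[of \<theta>], of "\<lambda>z. c * z"] by (simp add: algebra_simps)
        finally show ?thesis using 2 by simp
      next
        case 3
        have "v $ a = 2 * v $ Suc b - v $ b - (2 - 2 * cos \<theta>) * v $ Suc b" using eq[of "Suc b"] 3 less.prems by simp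
        also have "\<dots> = c * half_cos \<theta> (Suc (Suc b))"
          using arg_cong[OF half_cos_Suc[of \<theta> b], of "\<lambda>z. c * z"] less.IH[of b] less.IH[of "Suc b"] 3 less.prems
          by (simp add: algebra_simps)
        finally show ?thesis using 3 by simp
      qed
    qed
    then have eq: "v = c \<cdot>\<^sub>v vec m (half_cos \<theta>)" using v by (auto simp: vec_eq_iff)
    moreover have "c \<noteq> 0" using v eq by (auto simp: vec_eq_iff)
    ultimately show "\<exists>c. c \<noteq> 0 \<and> v = c \<cdot>\<^sub>v vec m (half_cos \<theta>)" by blast
  next
    assume "\<exists>c. c \<noteq> 0 \<and> v = c \<cdot>\<^sub>v vec m (half_cos \<theta>)"
    then obtain c where c: "c \<noteq> 0" "v = c \<cdot>\<^sub>v vec m (half_cos \<theta>)" by blast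
    have vc: "v \<in> carrier_vec m" using c by simp
    have v: "v $ a = c * half_cos \<theta> a" if "a < m" for a using c that by simp
    have "(N_matrix m *\<^sub>v v) $ a = (2 - 2 * cos \<theta>) * v $ a" if a: "a < m" for a
    proof -
      \<comment> \<open>For \<open>Suc a = m\<close> the absent neighbour agrees with the zero of
        the half cosine.\<close>
      have "(if Suc a < m then v $ Suc a else 0) = c * half_cos \<theta> (Suc a)"
        using zero a v by (metis Suc_lessI mult_zero_right)
      moreover have "(if a = 0 then v $ 0 else 2 * v $ a - v $ (a - 1)) =
          c * (if a = 0 then half_cos \<theta> 0 else 2 * half_cos \<theta> a - half_cos \<theta> (a - 1))"
        using a by (simp add: v algebra_simps)
      ultimately have "(N_matrix m *\<^sub>v v) $ a =
          c * ((if a = 0 then half_cos \<theta> 0 else 2 * half_cos \<theta> a - half_cos \<theta> (a - 1)) - half_cos \<theta> (Suc a))"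
        unfolding N_matrix_mult_vec[OF a vc] by (simp add: algebra_simps)
      also have "\<dots> = c * ((2 - 2 * cos \<theta>) * half_cos \<theta> a)"
        using half_cos_0[of \<theta>] half_cos_Suc[of \<theta> "a - 1"] by (cases a) auto
      finally show ?thesis using a by (simp add: v)
    qed
    moreover have "v $ 0 \<noteq> 0" using c first m by simp
    ultimately show "eigenvector (N_matrix m) v (N_eigenvalue q \<nu>)"
      using vc m unfolding eigenvector_def dim ev by (auto simp: vec_eq_iff dim)
  qed
qed

lemma length_concat_equal:
  assumes "\<And>xs. xs \<in> set xss \<Longrightarrow> length xs = q"
  shows "length (concat xss) = length xss * q"
  using assms by (induction xss) auto

lemma nth_concat_equal:
  assumes "\<And>xs. xs \<in> set xss \<Longrightarrow> length xs = q" and "a < length xss * q"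
  shows "concat xss ! a = xss ! (a div q) ! (a mod q)"
  using assms
proof (induction xss arbitrary: a)
  case (Cons xs xss)
  have len: "length xs = q" using Cons.prems by simp
  have q: "q > 0" using Cons.prems by (cases q) auto
  show ?case
  proof (cases "a < q")
    case True
    then show ?thesis using len by (simp add: nth_append)
  next
    case False
    then have "a div q = Suc ((a - q) div q)" "a mod q = (a - q) mod q"
      using q by (simp_all add: le_div_geq le_mod_geq)
    moreover have "concat xss ! (a - q) = xss ! ((a - q) div q) ! ((a - q) mod q)"
      using Cons.prems False by (intro Cons.IH) auto
    ultimately show ?thesis using False len by (simp add: nth_append)
  qed
qed simp

text \<open>Everything rests on \<open>q * \<theta>\<close> being an odd multiple of
  \<open>pi\<close>. The reflection \<open>r\<close> to \<open>q - 1 - r\<close> turns an argument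
  into \<open>q * \<theta>\<close> minus it, and a shift by \<open>q\<close> adds
  \<open>q * \<theta>\<close>; both reverse the sign of the cosine.\<close>

lemma block_vector_half_cos:
  fixes n q \<nu> :: nat
  assumes q: "odd q" "q dvd n" "n > 0" and \<nu>: "\<nu> \<in> {1..(q - 1) div 2}"
  defines "m \<equiv> (q - 1) div 2" and "\<theta> \<equiv> (2 * real \<nu> - 1) * pi / real q"
  shows "block_vector n q (c \<cdot>\<^sub>v vec m (half_cos \<theta>)) = c \<cdot>\<^sub>v path_mode n (n div q * (2 * \<nu> - 1))"
proof -
  define v where "v = c \<cdot>\<^sub>v vec m (half_cos \<theta>)"
  define B where "B = list_of_vec v @ [0] @ map uminus (rev (list_of_vec v))"
  have m: "q = 2 * m + 1" using q by (auto simp: m_def elim: oddE)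
  have t: "real (2 * \<nu> - 1) = 2 * real \<nu> - 1" using \<nu> by (simp add: of_nat_diff)
  have q\<theta>: "real q * \<theta> = real (2 * \<nu> - 1) * pi" using m t by (simp add: \<theta>_def)
  have odd: "cos (real q * \<theta>) = -1" "sin (real q * \<theta>) = 0"
    unfolding q\<theta> cos_npi sin_npi using \<nu> by (auto simp: odd_two_mult_minus_1)
  have lenB: "length B = q" by (simp add: B_def v_def m)
  \<comment> \<open>The three pieces of a block, \<open>v\<close>, the zero and the negated
    reversal, are samples of one cosine.\<close>
  have nthB: "B ! r = c * half_cos \<theta> r" if r: "r < q" for r
  proof -
    consider "r < m" | "r = m" | "m < r" by linarith
    then show ?thesis
    proof cases
      case 1
      then show ?thesis by (simp add: B_def nth_append v_def list_of_vec_index)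
    next
      case 2
      have "half_cos \<theta> m = cos (real q * \<theta> / 2)" by (simp add: half_cos_def m add.commute)
      moreover have "cos (real (2 * \<nu> - 1) * pi / 2) = 0"
        using \<nu> unfolding cos_zero_iff by (intro disjI1 exI[of _ "2 * \<nu> - 1"]) auto
      ultimately have "half_cos \<theta> m = 0" unfolding q\<theta> by simp
      then show ?thesis using 2 by (simp add: B_def nth_append v_def)
    next
      case 3
      then have "B ! r = - (c * half_cos \<theta> (q - 1 - r))"
        using r m by (simp add: B_def nth_append v_def rev_nth list_of_vec_index mult_2)
      also have "half_cos \<theta> (q - 1 - r) = cos (real q * \<theta> - (2 * real r + 1) * \<theta> / 2)"
        using r by (auto simp: half_cos_def of_nat_diff field_simps intro!: arg_cong[of _ _ cos])
      also have "\<dots> = - half_cos \<theta> r" by (simp add: cos_diff odd half_cos_def)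
      finally show ?thesis by simp
    qed
  qed
  have shift: "half_cos \<theta> (j * q + r) = (-1) ^ j * half_cos \<theta> r" for j r
  proof (induction j)
    case (Suc j)
    have "half_cos \<theta> (Suc j * q + r) = cos ((2 * real (j * q + r) + 1) * \<theta> / 2 + real q * \<theta>)"
      by (auto simp: half_cos_def field_simps intro!: arg_cong[of _ _ cos])
    also have "\<dots> = - half_cos \<theta> (j * q + r)" by (simp add: cos_add odd half_cos_def)
    finally show ?case using Suc by simp
  qed simp
  define Bs where "Bs = map (\<lambda>j. map (\<lambda>x. (-1) ^ (j - 1) * x) B) [1..<Suc (n div q)]"
  have Bs: "length xs = q" if "xs \<in> set Bs" for xs using that lenB by (auto simp: Bs_def)
  have len: "length (concat Bs) = n"
  proof -
    have "length Bs = n div q" by (simp add: Bs_def del: upt_Suc)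
    then show ?thesis using length_concat_equal[of Bs q] Bs q by simp
  qed
  have "concat Bs ! a = c * half_cos \<theta> a" if a: "a < n" for a
  proof -
    have nq: "a < n div q * q" unfolding dvd_div_mult_self[OF q(2)] by (rule a)
    then have "a div q < n div q" by (rule less_mult_imp_div_less)
    moreover have "a mod q < q" using m by simp
    moreover have "concat Bs ! a = Bs ! (a div q) ! (a mod q)"
    proof (rule nth_concat_equal[OF Bs])
      have "length Bs = n div q" by (simp add: Bs_def del: upt_Suc)
      then show "a < length Bs * q" using nq by simp
    qed
    \<comment> \<open>Blocks are numbered from 1 and list positions from 0, so the exponent
      \<open>j - 1\<close> is the position \<open>a div q\<close>.\<close>
    ultimately have "concat Bs ! a = (-1) ^ (a div q) * (c * half_cos \<theta> (a mod q))"
      by (simp add: Bs_def lenB nthB del: upt_Suc)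
    then show ?thesis using shift[of "a div q" "a mod q"] by simp
  qed
  moreover have "real (n div q * (2 * \<nu> - 1)) * pi / real n = \<theta>"
    using q t by (simp add: \<theta>_def real_of_nat_div)
  ultimately show ?thesis
    unfolding block_vector_def v_def[symmetric] B_def[symmetric] Bs_def[symmetric]
    using len by (auto simp: vec_eq_iff path_mode_def vec_of_list_index)
qed

text \<open>This removes the block description: from here on the vectors in question are nonzero
  multiples of a path mode.\<close>

lemma is_V_iff:
  assumes "odd q" "q dvd n" "n > 0" "\<nu> \<in> {1..(q - 1) div 2}"
  shows "is_V n q \<nu> V \<longleftrightarrow> (\<exists>c. c \<noteq> 0 \<and> V = c \<cdot>\<^sub>v path_mode n (n div q * (2 * \<nu> - 1)))"
  unfolding is_V_def N_matrix_eigenvector_iff[OF assms(1,4)]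
proof
  assume "\<exists>v. (\<exists>c. c \<noteq> 0 \<and> v = c \<cdot>\<^sub>v vec ((q - 1) div 2) (half_cos ((2 * real \<nu> - 1) * pi / real q))) \<and>
    V = block_vector n q v"
  then show "\<exists>c. c \<noteq> 0 \<and> V = c \<cdot>\<^sub>v path_mode n (n div q * (2 * \<nu> - 1))"
    using block_vector_half_cos[OF assms] by blast
next
  assume "\<exists>c. c \<noteq> 0 \<and> V = c \<cdot>\<^sub>v path_mode n (n div q * (2 * \<nu> - 1))"
  then show "\<exists>v. (\<exists>c. c \<noteq> 0 \<and> v = c \<cdot>\<^sub>v vec ((q - 1) div 2) (half_cos ((2 * real \<nu> - 1) * pi / real q))) \<and>
    V = block_vector n q v"
    using block_vector_half_cos[OF assms, symmetric] by blast
qed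

subsection \<open>Divisors of \<open>gcd(n, 2x - 1)\<close>\<close>

text \<open>Adding \<open>x\<close> to both sides of the congruence gives \<open>n\<close> and
  \<open>2 * x - 1\<close>, and \<open>n\<close> is 0 modulo \<open>p\<close>. Oddness of
  \<open>p\<close> comes from that of \<open>2 * x - 1\<close>.\<close>

lemma symmetric_mod_iff:
  assumes "x \<in> {1..n}"
  shows "symmetric_mod n x p \<longleftrightarrow> prime p \<and> p dvd gcd n (2 * x - 1)"
proof -
  have "[n - x = x - 1] (mod p) \<longleftrightarrow> p dvd 2 * x - 1" if "p dvd n"
  proof -
    have "n - x + x = n" "x - 1 + x = 2 * x - 1" using assms by auto
    then have "[n - x = x - 1] (mod p) \<longleftrightarrow> [n = 2 * x - 1] (mod p)"
      using cong_add_rcancel_nat[of "n - x" x "x - 1" p] by simp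
    also have "[n = 2 * x - 1] (mod p) \<longleftrightarrow> p dvd 2 * x - 1"
      using that by (metis cong_0_iff cong_sym cong_trans)
    finally show ?thesis .
  qed
  moreover have "odd p" if "p dvd 2 * x - 1"
    using that assms odd_two_mult_minus_1[of x] by (meson atLeastAtMost_iff dvd_trans)
  ultimately show ?thesis unfolding symmetric_mod_def by auto
qed

text \<open>For \<open>x = h * q - (q - 1) div 2\<close> one has
  \<open>2 * x - 1 = (2 * h - 1) * q\<close>. Conversely the quotient of \<open>2 * x - 1\<close> by
  \<open>q\<close> is odd, which recovers \<open>h\<close>.\<close>

lemma block_centres_iff:
  assumes "odd q" "q dvd n" "x \<in> {1..n}"
  shows "x \<in> block_centres n q \<longleftrightarrow> q dvd 2 * x - 1"
proof -
  obtain m where m: "q = 2 * m + 1" using assms by (elim oddE)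
  obtain s where s: "n = q * s" using assms by blast
  show ?thesis
  proof
    assume "x \<in> block_centres n q"
    then obtain h where h: "h \<in> {1..n div q}" "x = h * q - m" by (auto simp: block_centres_def m)
    then obtain h' where h': "h = Suc h'" by (cases h) auto
    have "2 * x - 1 = (2 * h' + 1) * q" using h by (simp add: h' m algebra_simps)
    then show "q dvd 2 * x - 1" by simp
  next
    assume "q dvd 2 * x - 1"
    then obtain t where t: "2 * x - 1 = q * t" by blast
    have "odd (q * t)" using assms odd_two_mult_minus_1[of x] unfolding t[symmetric] by simp
    then have "odd t" by simp
    then obtain h where h: "t = 2 * h + 1" by (elim oddE)
    have x: "x = Suc h * q - m" using t assms by (simp add: h m algebra_simps)
    \<comment> \<open>The bound \<open>x \<le> n\<close> gives \<open>2 * h + 1 < 2 * s\<close>,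
      which is the required \<open>Suc h \<le> n div q\<close>.\<close>
    have "2 * x - 1 < 2 * n" using assms by auto
    then have "q * t < q * (2 * s)" unfolding t s by (simp add: mult.left_commute)
    then have "t < 2 * s" using mult_less_cancel1 by blast
    then have "Suc h \<le> s" using h by simp
    moreover have "q \<noteq> 0" using m by simp
    then have "n div q = s" unfolding s by (rule nonzero_mult_div_cancel_left)
    ultimately have "Suc h \<in> {1..n div q}" by simp
    then show "x \<in> block_centres n q" unfolding block_centres_def using x m by (intro CollectI exI[of _ "Suc h"]) simp
  qed
qed

lemma max_exponent_eq_multiplicity:
  assumes x: "x \<in> {1..n}" and p: "symmetric_mod n x p"
  shows "max_exponent n x p = multiplicity p (gcd n (2 * x - 1))"
proof -
  let ?g = "gcd n (2 * x - 1)"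
  have p': "prime p" "p dvd ?g" "odd p" "?g \<noteq> 0" using p x symmetric_mod_iff[OF x] by (auto simp: symmetric_mod_def)
  have iff: "(1 \<le> \<alpha> \<and> p ^ \<alpha> dvd n \<and> x \<in> block_centres n (p ^ \<alpha>)) \<longleftrightarrow> 1 \<le> \<alpha> \<and> \<alpha> \<le> multiplicity p ?g" for \<alpha>
  proof -
    have "p ^ \<alpha> dvd n \<and> x \<in> block_centres n (p ^ \<alpha>) \<longleftrightarrow> p ^ \<alpha> dvd n \<and> p ^ \<alpha> dvd 2 * x - 1"
      using block_centres_iff[of "p ^ \<alpha>" n x] x p' by auto
    also have "\<dots> \<longleftrightarrow> p ^ \<alpha> dvd ?g" by (rule gcd_greatest_iff[symmetric])
    also have "\<dots> \<longleftrightarrow> \<alpha> \<le> multiplicity p ?g"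
      using p' not_prime_unit by (intro power_dvd_iff_le_multiplicity) auto
    finally show ?thesis by blast
  qed
  have "multiplicity p ?g \<ge> 1" using p' by (metis multiplicity_geI power_one_right not_prime_unit)
  then show ?thesis unfolding max_exponent_def iff by (intro Greatest_equality) auto
qed

text \<open>The enumerated primes are exactly the prime factors of the gcd and the exponents are
  their multiplicities, so the product is its prime factorisation.\<close>

lemma prod_max_exponent:
  assumes x: "x \<in> {1..n}" and q: "bij_betw q {1..k::nat} {p. symmetric_mod n x p}"
  shows "(\<Prod>j=1..k. q j ^ max_exponent n x (q j)) = gcd n (2 * x - 1)"
proof -
  let ?g = "gcd n (2 * x - 1)"
  have "{p. symmetric_mod n x p} = prime_factors ?g"
    using symmetric_mod_iff[OF x] x by (auto simp: prime_factors_dvd)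
  then have "(\<Prod>j=1..k. q j ^ max_exponent n x (q j)) = (\<Prod>p\<in>prime_factors ?g. p ^ max_exponent n x p)"
    using prod.reindex_bij_betw[OF q, of "\<lambda>p. p ^ max_exponent n x p"] by simp
  also have "\<dots> = (\<Prod>p\<in>prime_factors ?g. p ^ multiplicity p ?g)"
    using max_exponent_eq_multiplicity[OF x] symmetric_mod_iff[OF x]
    by (intro prod.cong refl) (simp add: in_prime_factors_iff)
  also have "\<dots> = ?g" using x by (subst prod_prime_factors) auto
  finally show ?thesis .
qed

subsection \<open>Controllability of graphs with simple spectrum\<close>

text \<open>The sum runs over nodes instead of positions: in the grid, neighbours are easy to
  describe as tuples but not by their lexicographic positions.\<close>

lemma laplacian_mult_node_function:
  assumes G: "distinct (nodes G)" and a: "a < num_nodes G"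
    and v: "v = vec (num_nodes G) (\<lambda>b. g (nodes G ! b))"
  shows "(laplacian G *\<^sub>v v) $ a =
    (\<Sum>y | y \<in> set (nodes G) \<and> adj G (nodes G ! a) y. g (nodes G ! a) - g y)"
proof -
  define I where "I = {b. b < num_nodes G \<and> adj G (nodes G ! a) (nodes G ! b)}"
  have "{y \<in> set (nodes G). adj G (nodes G ! a) y} = (!) (nodes G) ` I"
    by (auto simp: I_def num_nodes_def in_set_conv_nth)
  moreover have "inj_on ((!) (nodes G)) I"
    using G by (auto simp: I_def num_nodes_def inj_on_def nth_eq_iff_index_eq)
  ultimately have "(\<Sum>y | y \<in> set (nodes G) \<and> adj G (nodes G ! a) y. g (nodes G ! a) - g y) =
      (\<Sum>b\<in>I. g (nodes G ! a) - g (nodes G ! b))"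
    by (simp add: sum.reindex)
  also have "\<dots> = (\<Sum>b\<in>I. v $ a - v $ b)" using a by (intro sum.cong) (auto simp: v I_def)
  also have "\<dots> = (laplacian G *\<^sub>v v) $ a"
    unfolding I_def by (rule laplacian_mult_vec[OF G a, symmetric]) (simp add: v)
  finally show ?thesis ..
qed

text \<open>The columns of the input matrix are unit vectors, so orthogonality to them means zero
  components at the nodes of \<open>S\<close>.\<close>

lemma controllable_from_iff:
  assumes "symmetric_simple_spectrum (laplacian G) (num_nodes G) K e lam" and N: "num_nodes G \<noteq> 0"
  shows "controllable_from G S \<longleftrightarrow> \<not> (\<exists>w x. uncontrollable_eigenvector G S w x)"
    and "observable_from G S \<longleftrightarrow> \<not> (\<exists>w x. uncontrollable_eigenvector G S w x)"
proof -
  interpret symmetric_simple_spectrum "laplacian G" "num_nodes G" K e lam by fact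
  define as where "as = filter (\<lambda>a. nodes G ! a \<in> S) [0..<num_nodes G]"
  define B where "B = input_matrix G S"
  have B: "B \<in> carrier_mat (num_nodes G) (length as)"
    unfolding B_def input_matrix_def as_def[symmetric]
    using mat_of_cols_carrier(1)[of "num_nodes G" "map (unit_vec (num_nodes G)) as"] by simp
  have cols: "set (cols B) = unit_vec (num_nodes G) ` set as"
    unfolding B_def input_matrix_def as_def[symmetric] by (subst cols_mat_of_cols) auto
  have "(\<forall>b\<in>set (cols B). b \<bullet> w = 0) \<longleftrightarrow> (\<forall>a<num_nodes G. nodes G ! a \<in> S \<longrightarrow> w $ a = 0)"
    if "eigenvector (laplacian G) w x" for w x
  proof -
    have "w \<in> carrier_vec (num_nodes G)" using that by (simp add: eigenvector_def)
    then show ?thesis unfolding cols by (auto simp: as_def)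
  qed
  then have *: "(\<exists>w x. eigenvector (laplacian G) w x \<and> (\<forall>b\<in>set (cols B). b \<bullet> w = 0)) \<longleftrightarrow>
      (\<exists>w x. uncontrollable_eigenvector G S w x)"
    unfolding uncontrollable_eigenvector_def by blast
  show "controllable_from G S \<longleftrightarrow> \<not> (\<exists>w x. uncontrollable_eigenvector G S w x)"
    using controllable_pair_iff[OF N B] unfolding controllable_from_def B_def[symmetric] * .
  show "observable_from G S \<longleftrightarrow> \<not> (\<exists>w x. uncontrollable_eigenvector G S w x)"
    using observable_pair_iff[OF N B] unfolding observable_from_def output_matrix_def B_def[symmetric] * .
qed

lemma unobservable_eq_uncontrollable:
  "unobservable_eigenvector = uncontrollable_eigenvector"
  "unobservable_eigenvalue = uncontrollable_eigenvalue"
  unfolding fun_eq_iff unobservable_eigenvalue_def uncontrollable_eigenvalue_def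
    unobservable_eigenvector_def uncontrollable_eigenvector_def by simp_all

text \<open>Eigenvectors of the path are multiples of modes, so only the modes that vanish at
  \<open>x\<close> matter; the mode of index \<open>n div g * (2 * \<nu> - 1)\<close> has the
  eigenvalue \<open>N_eigenvalue g \<nu>\<close>.\<close>

lemma uncontrollable_eigenvalues_path:
  assumes x: "x \<in> {1..n}"
  defines "g \<equiv> gcd n (2 * x - 1)"
  shows "{y. uncontrollable_eigenvalue (path_graph n) {x} y} = {N_eigenvalue g \<nu> | \<nu>. \<nu> \<in> {1..(g - 1) div 2}}"
proof -
  have n: "n > 0" using x by simp
  have "uncontrollable_eigenvalue (path_graph n) {x} y \<longleftrightarrow>
      (\<exists>k<n. y = path_eigenvalue n k \<and> path_mode n k $ (x - 1) = 0)" for y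
  proof -
    have node: "(\<forall>a<n. nodes (path_graph n) ! a \<in> {x} \<longrightarrow> w $ a = 0) \<longleftrightarrow> w $ (x - 1) = 0" for w :: "real vec"
    proof -
      have "nodes (path_graph n) ! a \<in> {x} \<longleftrightarrow> a = x - 1" if "a < n" for a
        using x nth_nodes_path_graph[OF that] by auto
      then show ?thesis using x by auto
    qed
    show ?thesis
      unfolding uncontrollable_eigenvalue_def uncontrollable_eigenvector_def num_nodes_path_graph node
        path_eigenvector_iff
    proof
      assume "\<exists>w. (\<exists>k\<in>{..<n}. \<exists>c. c \<noteq> 0 \<and> w = c \<cdot>\<^sub>v path_mode n k \<and> y = path_eigenvalue n k) \<and> w $ (x - 1) = 0"
      then obtain k c where "k < n" "c \<noteq> 0" "y = path_eigenvalue n k" "(c \<cdot>\<^sub>v path_mode n k) $ (x - 1) = 0"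
        by auto
      then show "\<exists>k<n. y = path_eigenvalue n k \<and> path_mode n k $ (x - 1) = 0" using x by auto
    next
      assume "\<exists>k<n. y = path_eigenvalue n k \<and> path_mode n k $ (x - 1) = 0"
      then obtain k where k: "k < n" "y = path_eigenvalue n k" "path_mode n k $ (x - 1) = 0" by blast
      have "path_mode n k = 1 \<cdot>\<^sub>v path_mode n k" by simp
      then show "\<exists>w. (\<exists>k\<in>{..<n}. \<exists>c. c \<noteq> 0 \<and> w = c \<cdot>\<^sub>v path_mode n k \<and> y = path_eigenvalue n k) \<and> w $ (x - 1) = 0"
        using k zero_neq_one lessThan_iff by metis
    qed
  qed
  then have "{y. uncontrollable_eigenvalue (path_graph n) {x} y} =
      {y. \<exists>k<n. y = path_eigenvalue n k \<and> path_mode n k $ (x - 1) = 0}" by simp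
  also have "\<dots> =
      {N_eigenvalue g \<nu> | \<nu>. \<nu> \<in> {1..(g - 1) div 2}}" (is "?A = ?B")
  proof (intro subset_antisym subsetI)
    fix y assume "y \<in> ?A"
    then obtain k where k: "k < n" "y = path_eigenvalue n k" "path_mode n k $ (x - 1) = 0" by blast
    then obtain \<nu> where \<nu>: "\<nu> \<in> {1..(g - 1) div 2}" "k = n div g * (2 * \<nu> - 1)"
      using path_mode_eq_0_iff[OF x k(1)] unfolding g_def by blast
    then have "y = N_eigenvalue g \<nu>" using N_eigenvalue_eq_path_eigenvalue[of g n \<nu>] n k by (simp add: g_def)
    then show "y \<in> ?B" using \<nu> by blast
  next
    fix y assume "y \<in> ?B"
    then obtain \<nu> where \<nu>: "\<nu> \<in> {1..(g - 1) div 2}" "y = N_eigenvalue g \<nu>" by blast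
    define k where "k = n div g * (2 * \<nu> - 1)"
    have "k < n div g * g"
      unfolding k_def using \<nu> n by (intro mult_strict_left_mono) (auto simp: g_def div_greater_zero_iff intro: dvd_imp_le)
    then have "k < n" by (simp add: g_def)
    moreover have "y = path_eigenvalue n k"
      using N_eigenvalue_eq_path_eigenvalue[of g n \<nu>] n \<nu> by (simp add: g_def k_def)
    moreover have "path_mode n k $ (x - 1) = 0"
      using path_mode_eq_0_iff[OF x \<open>k < n\<close>] \<nu>(1) unfolding g_def[symmetric] k_def by blast
    ultimately show "y \<in> ?A" by blast
  qed
  finally show ?thesis .
qed

subsection \<open>The spectrum of the grid\<close>

lemma nodes_grid_graph: "nodes (grid_graph ns) = product_lists (map (\<lambda>n. [1..<Suc n]) ns)"
  by (simp add: grid_graph_def cartesian_product_def comp_def nodes_path_graph del: upt_Suc)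

lemma in_nodes_grid_graph_iff:
  "x \<in> set (nodes (grid_graph ns)) \<longleftrightarrow> length x = length ns \<and> (\<forall>k<length ns. x ! k \<in> {1..ns ! k})"
  by (auto simp: nodes_grid_graph product_lists_set list_all2_conv_all_nth less_Suc_eq_le simp del: upt_Suc)

lemma distinct_nodes_grid_graph: "distinct (nodes (grid_graph ns))"
  unfolding nodes_grid_graph by (rule distinct_product_lists) (auto simp del: upt_Suc)

lemma num_nodes_grid_graph: "num_nodes (grid_graph ns) = (\<Prod>k<length ns. ns ! k)"
proof -
  have "length (product_lists (map (\<lambda>n. [1..<Suc n]) ns)) = prod_list ns"
    by (induction ns) (auto simp: length_concat comp_def sum_list_triv simp del: upt_Suc)
  then show ?thesis by (simp add: num_nodes_def nodes_grid_graph prod.list_conv_set_nth atLeast0LessThan del: upt_Suc)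
qed

lemma adj_grid_graph_iff:
  assumes x: "x \<in> set (nodes (grid_graph ns))"
  shows "y \<in> set (nodes (grid_graph ns)) \<and> adj (grid_graph ns) x y \<longleftrightarrow>
    (\<exists>k<length ns. \<exists>z. z \<in> {1..ns ! k} \<and> adj (path_graph (ns ! k)) (x ! k) z \<and> y = x[k := z])"
proof -
  have len: "length x = length ns" using x by (simp add: in_nodes_grid_graph_iff)
  have adj: "adj (grid_graph ns) x y \<longleftrightarrow> y \<in> set (nodes (grid_graph ns)) \<and>
      (\<exists>k<length ns. adj (path_graph (ns ! k)) (x ! k) (y ! k) \<and> (\<forall>l<length ns. l \<noteq> k \<longrightarrow> x ! l = y ! l))" for y
    using x by (auto simp: grid_graph_def cartesian_product_def)
  show ?thesis
  proof
    assume "y \<in> set (nodes (grid_graph ns)) \<and> adj (grid_graph ns) x y"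
    then obtain k where y: "y \<in> set (nodes (grid_graph ns))" and k: "k < length ns"
      "adj (path_graph (ns ! k)) (x ! k) (y ! k)" "\<forall>l<length ns. l \<noteq> k \<longrightarrow> x ! l = y ! l"
      unfolding adj by blast
    have "y = x[k := y ! k]"
      using k len y by (intro nth_equalityI) (auto simp: in_nodes_grid_graph_iff nth_list_update)
    moreover have "y ! k \<in> {1..ns ! k}" using y k by (auto simp: in_nodes_grid_graph_iff)
    ultimately show "\<exists>k<length ns. \<exists>z. z \<in> {1..ns ! k} \<and> adj (path_graph (ns ! k)) (x ! k) z \<and> y = x[k := z]"
      using k by blast
  next
    assume "\<exists>k<length ns. \<exists>z. z \<in> {1..ns ! k} \<and> adj (path_graph (ns ! k)) (x ! k) z \<and> y = x[k := z]"
    then obtain k z where k: "k < length ns" "z \<in> {1..ns ! k}" "adj (path_graph (ns ! k)) (x ! k) z" "y = x[k := z]"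
      by blast
    have y: "y \<in> set (nodes (grid_graph ns))"
      using k x by (auto simp: in_nodes_grid_graph_iff nth_list_update)
    moreover have "adj (path_graph (ns ! k)) (x ! k) (y ! k) \<and> (\<forall>l<length ns. l \<noteq> k \<longrightarrow> x ! l = y ! l)"
      using k len by auto
    ultimately show "y \<in> set (nodes (grid_graph ns)) \<and> adj (grid_graph ns) x y"
      unfolding adj using k(1) by blast
  qed
qed

text \<open>A neighbour is given by a direction and a new coordinate. The pair can be recovered from
  the neighbour because paths have no loops: the changed coordinate really changes and so reveals
  the direction.\<close>

lemma sum_neighbours_grid_graph:
  fixes h :: "nat list \<Rightarrow> real"
  assumes x: "x \<in> set (nodes (grid_graph ns))"
  shows "(\<Sum>y | y \<in> set (nodes (grid_graph ns)) \<and> adj (grid_graph ns) x y. h y) =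
    (\<Sum>k<length ns. \<Sum>z | z \<in> {1..ns ! k} \<and> adj (path_graph (ns ! k)) (x ! k) z. h (x[k := z]))"
proof -
  define D where "D = (SIGMA k:{..<length ns}. {z. z \<in> {1..ns ! k} \<and> adj (path_graph (ns ! k)) (x ! k) z})"
  have len: "length x = length ns" using x by (simp add: in_nodes_grid_graph_iff)
  have ne: "z \<noteq> x ! k" if "(k, z) \<in> D" for k z using that by (auto simp: D_def path_graph_def)
  have "inj_on (\<lambda>(k, z). x[k := z]) D"
  proof (rule inj_onI, clarify)
    fix k z k' z' assume D: "(k, z) \<in> D" "(k', z') \<in> D" and eq: "x[k := z] = x[k' := z']"
    have k: "k < length x" "k' < length x" using D len by (auto simp: D_def)
    have "k = k'"
    proof (rule ccontr)
      assume "k \<noteq> k'"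
      then have "z = x ! k" using arg_cong[OF eq, of "\<lambda>l. l ! k"] k by simp
      with ne[OF D(1)] show False ..
    qed
    then show "k = k' \<and> z = z'" using arg_cong[OF eq, of "\<lambda>l. l ! k"] k by simp
  qed
  moreover have "{y. y \<in> set (nodes (grid_graph ns)) \<and> adj (grid_graph ns) x y} = (\<lambda>(k, z). x[k := z]) ` D"
    unfolding adj_grid_graph_iff[OF x] D_def by (auto simp: image_iff)
  ultimately have "(\<Sum>y | y \<in> set (nodes (grid_graph ns)) \<and> adj (grid_graph ns) x y. h y) =
      (\<Sum>(k, z)\<in>D. h (x[k := z]))"
    by (simp add: sum.reindex case_prod_unfold)
  also have "\<dots> = (\<Sum>k<length ns. \<Sum>z | z \<in> {1..ns ! k} \<and> adj (path_graph (ns ! k)) (x ! k) z. h (x[k := z]))"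
    unfolding D_def by (rule sum.Sigma[symmetric]) auto
  finally show ?thesis .
qed

section \<open>Tensor products as eigenvectors of the grid\<close>

lemma grid_tensor_carrier [simp]:
  "grid_tensor ns u \<in> carrier_vec (num_nodes (grid_graph ns))"
  "dim_vec (grid_tensor ns u) = num_nodes (grid_graph ns)"
  by (simp_all add: grid_tensor_def)

text \<open>The grid Laplacian is a Kronecker sum: along direction \<open>k\<close> only the
  \<open>k\<close>-th factor of the product changes, so the differences in this direction form a
  path Laplacian times the remaining factors and contribute \<open>lam k\<close>.\<close>

lemma grid_tensor_eigenvector:
  assumes u: "\<And>k. k < length ns \<Longrightarrow> eigenvector (laplacian (path_graph (ns ! k))) (u k) (lam k)"
  shows "eigenvector (laplacian (grid_graph ns)) (grid_tensor ns u) (\<Sum>k<length ns. lam k)"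
proof -
  let ?G = "grid_graph ns"
  define T where "T x = (\<Prod>k<length ns. u k $ (x ! k - 1))" for x :: "nat list"
  have tensor: "grid_tensor ns u = vec (num_nodes ?G) (\<lambda>a. T (nodes ?G ! a))"
    by (simp add: grid_tensor_def T_def)
  have path: "(\<Sum>z | z \<in> {1..ns ! k} \<and> adj (path_graph (ns ! k)) y z. u k $ (y - 1) - u k $ (z - 1)) =
      lam k * u k $ (y - 1)" if k: "k < length ns" and y: "y \<in> {1..ns ! k}" for k y
  proof -
    let ?P = "path_graph (ns ! k)"
    have uk: "u k \<in> carrier_vec (ns ! k)" "laplacian ?P *\<^sub>v u k = lam k \<cdot>\<^sub>v u k"
      using u[OF k] by (auto simp: eigenvector_def)
    have "u k = vec (num_nodes ?P) (\<lambda>b. u k $ (nodes ?P ! b - 1))"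
      using uk by (auto simp: vec_eq_iff nth_nodes_path_graph)
    moreover have y1: "y - 1 < num_nodes ?P" "nodes ?P ! (y - 1) = y"
      using y nth_nodes_path_graph[of "y - 1" "ns ! k"] by auto
    moreover have "distinct (nodes ?P)" by (simp add: nodes_path_graph del: upt_Suc)
    ultimately
    have "(laplacian ?P *\<^sub>v u k) $ (y - 1) =
        (\<Sum>z | z \<in> set (nodes ?P) \<and> adj ?P y z. u k $ (y - 1) - u k $ (z - 1))"
      using laplacian_mult_node_function[where g = "\<lambda>z. u k $ (z - 1)" and v = "u k" and G = ?P and a = "y - 1"]
      by metis
    moreover have "set (nodes ?P) = {1..ns ! k}" by (auto simp: nodes_path_graph simp del: upt_Suc)
    ultimately show ?thesis using uk y1 by simp
  qed
  have "(laplacian ?G *\<^sub>v grid_tensor ns u) $ a = (\<Sum>k<length ns. lam k) * grid_tensor ns u $ a"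
    if a: "a < num_nodes ?G" for a
  proof -
    define x where "x = nodes ?G ! a"
    have x: "x \<in> set (nodes ?G)" using a by (simp add: x_def num_nodes_def)
    then have len: "length x = length ns" by (simp add: in_nodes_grid_graph_iff)
    define r where "r k = (\<Prod>l\<in>{..<length ns} - {k}. u l $ (x ! l - 1))" for k
    have T: "T (x[k := z]) = u k $ (z - 1) * r k" if "k < length ns" for k z
    proof -
      have "T (x[k := z]) = u k $ (x[k := z] ! k - 1) * (\<Prod>l\<in>{..<length ns} - {k}. u l $ (x[k := z] ! l - 1))"
        unfolding T_def using that by (subst prod.remove[of _ k]) auto
      also have "(\<Prod>l\<in>{..<length ns} - {k}. u l $ (x[k := z] ! l - 1)) = r k"
        unfolding r_def by (intro prod.cong) auto
      finally show ?thesis using that len by simp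
    qed
    have Tx: "T x = u k $ (x ! k - 1) * r k" if "k < length ns" for k using T[OF that, of "x ! k"] by simp
    have "(laplacian ?G *\<^sub>v grid_tensor ns u) $ a =
        (\<Sum>y | y \<in> set (nodes ?G) \<and> adj ?G x y. T x - T y)"
      unfolding x_def by (rule laplacian_mult_node_function[OF distinct_nodes_grid_graph a tensor])
    also have "\<dots> = (\<Sum>k<length ns. \<Sum>z | z \<in> {1..ns ! k} \<and> adj (path_graph (ns ! k)) (x ! k) z. T x - T (x[k := z]))"
      by (rule sum_neighbours_grid_graph[OF x])
    also have "\<dots> = (\<Sum>k<length ns. lam k * T x)"
    proof (rule sum.cong[OF refl])
      fix k assume "k \<in> {..<length ns}"
      then have k: "k < length ns" by simp
      then have xk: "x ! k \<in> {1..ns ! k}" using x by (simp add: in_nodes_grid_graph_iff)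
      have "(\<Sum>z | z \<in> {1..ns ! k} \<and> adj (path_graph (ns ! k)) (x ! k) z. T x - T (x[k := z])) =
          (\<Sum>z | z \<in> {1..ns ! k} \<and> adj (path_graph (ns ! k)) (x ! k) z. u k $ (x ! k - 1) - u k $ (z - 1)) * r k"
        unfolding sum_distrib_right using T[OF k] Tx[OF k] by (simp add: algebra_simps)
      also have "\<dots> = lam k * T x" unfolding path[OF k xk] Tx[OF k] by simp
      finally show "(\<Sum>z | z \<in> {1..ns ! k} \<and> adj (path_graph (ns ! k)) (x ! k) z. T x - T (x[k := z])) = lam k * T x" .
    qed
    finally show ?thesis using a by (simp add: tensor x_def sum_distrib_right)
  qed
  moreover have "grid_tensor ns u \<noteq> 0\<^sub>v (num_nodes ?G)"
  proof -
    \<comment> \<open>A nonzero entry chosen in every factor gives a node at which the product is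
      nonzero.\<close>
    have "\<exists>a<ns ! k. u k $ a \<noteq> 0" if "k < length ns" for k
      using u[OF that] by (auto simp: eigenvector_def vec_eq_iff)
    then obtain f where f: "\<And>k. k < length ns \<Longrightarrow> f k < ns ! k \<and> u k $ f k \<noteq> 0" by metis
    define x where "x = map (\<lambda>k. Suc (f k)) [0..<length ns]"
    have "x \<in> set (nodes ?G)" using f by (auto simp: in_nodes_grid_graph_iff x_def Suc_le_eq)
    then obtain a where a: "a < num_nodes ?G" "nodes ?G ! a = x" by (auto simp: in_set_conv_nth num_nodes_def)
    have "T x \<noteq> 0" using f by (simp add: T_def x_def)
    then have "grid_tensor ns u $ a \<noteq> 0" using a by (simp add: tensor)
    then show ?thesis using a by auto
  qed
  ultimately show ?thesis by (auto simp: eigenvector_def vec_eq_iff)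
qed

lemma grid_tensor_cong:
  assumes "\<And>k. k < length ns \<Longrightarrow> u k = v k"
  shows "grid_tensor ns u = grid_tensor ns v"
  using assms by (simp add: grid_tensor_def)

lemma grid_tensor_smult:
  assumes "\<And>k. k < length ns \<Longrightarrow> u k \<in> carrier_vec (ns ! k)"
  shows "grid_tensor ns (\<lambda>k. c k \<cdot>\<^sub>v u k) = (\<Prod>k<length ns. c k) \<cdot>\<^sub>v grid_tensor ns u"
proof (rule eq_vecI)
  fix a assume "a < dim_vec ((\<Prod>k<length ns. c k) \<cdot>\<^sub>v grid_tensor ns u)"
  then have a: "a < num_nodes (grid_graph ns)" by simp
  then have "nodes (grid_graph ns) ! a \<in> set (nodes (grid_graph ns))" by (simp add: num_nodes_def)
  then have "nodes (grid_graph ns) ! a ! k \<in> {1..ns ! k}" if "k < length ns" for k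
    using that by (simp add: in_nodes_grid_graph_iff)
  then have "(c k \<cdot>\<^sub>v u k) $ (nodes (grid_graph ns) ! a ! k - 1) = c k * u k $ (nodes (grid_graph ns) ! a ! k - 1)"
    if "k < length ns" for k
    using assms[OF that] that by (intro index_smult_vec) fastforce
  then show "grid_tensor ns (\<lambda>k. c k \<cdot>\<^sub>v u k) $ a = ((\<Prod>k<length ns. c k) \<cdot>\<^sub>v grid_tensor ns u) $ a"
    using a by (simp add: grid_tensor_def prod.distrib)
qed simp

section \<open>The modes of the grid\<close>

definition grid_mode :: "nat list \<Rightarrow> (nat \<Rightarrow> nat) \<Rightarrow> real vec" where
  "grid_mode ns \<kappa> = grid_tensor ns (\<lambda>k. path_mode (ns ! k) (\<kappa> k))"

definition grid_eigenvalue :: "nat list \<Rightarrow> (nat \<Rightarrow> nat) \<Rightarrow> real" where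
  "grid_eigenvalue ns \<kappa> = (\<Sum>k<length ns. path_eigenvalue (ns ! k) (\<kappa> k))"

text \<open>Functions with a fixed value outside the directions, so that the set is finite and has
  as many elements as the grid has nodes.\<close>

definition mode_indices :: "nat list \<Rightarrow> (nat \<Rightarrow> nat) set" where
  "mode_indices ns = PiE {..<length ns} (\<lambda>k. {..<ns ! k})"

lemma grid_spectrum:
  assumes "simple_grid ns"
  shows "symmetric_simple_spectrum (laplacian (grid_graph ns)) (num_nodes (grid_graph ns))
    (mode_indices ns) (grid_mode ns) (grid_eigenvalue ns)"
proof
  show "laplacian (grid_graph ns) \<in> carrier_mat (num_nodes (grid_graph ns)) (num_nodes (grid_graph ns))" by simp
  show "(laplacian (grid_graph ns))\<^sup>T = laplacian (grid_graph ns)"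
  proof (rule transpose_laplacian)
    have "adj (path_graph n) x y = adj (path_graph n) y x" for n x y by (auto simp: path_graph_def)
    then show "adj (grid_graph ns) x y = adj (grid_graph ns) y x" for x y
      unfolding grid_graph_def cartesian_product_def by (auto; metis)
  qed
  show "finite (mode_indices ns)" by (simp add: mode_indices_def finite_PiE)
  show "card (mode_indices ns) = num_nodes (grid_graph ns)"
    by (simp add: mode_indices_def card_PiE num_nodes_grid_graph)
  show "eigenvector (laplacian (grid_graph ns)) (grid_mode ns \<kappa>) (grid_eigenvalue ns \<kappa>)"
    if "\<kappa> \<in> mode_indices ns" for \<kappa>
    unfolding grid_mode_def grid_eigenvalue_def using that
    by (intro grid_tensor_eigenvector path_mode_eigenvector) (auto simp: mode_indices_def)
  show "inj_on (grid_eigenvalue ns) (mode_indices ns)"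
  proof (rule inj_onI)
    fix \<kappa> \<kappa>' assume \<kappa>: "\<kappa> \<in> mode_indices ns" and \<kappa>': "\<kappa>' \<in> mode_indices ns"
      and eq: "grid_eigenvalue ns \<kappa> = grid_eigenvalue ns \<kappa>'"
    \<comment> \<open>\<open>simple_grid\<close> speaks of tuples of eigenvalues. \<open>L\<close>
      passes from indices to such tuples, and injectivity of \<open>path_eigenvalue\<close> leads
      back.\<close>
    define L where "L \<kappa> = (\<lambda>k\<in>{..<length ns}. path_eigenvalue (ns ! k) (\<kappa> k))" for \<kappa> :: "nat \<Rightarrow> nat"
    have L: "L \<kappa> \<in> PiE {..<length ns} (\<lambda>k. {x. eigenvalue (laplacian (path_graph (ns ! k))) x})"
      if "\<kappa> \<in> mode_indices ns" for \<kappa>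
      using that by (auto simp: L_def path_eigenvalue_iff mode_indices_def)
    have "(\<Sum>k<length ns. L \<kappa> k) = (\<Sum>k<length ns. L \<kappa>' k)"
      using eq by (simp add: L_def grid_eigenvalue_def)
    then have LL: "L \<kappa> = L \<kappa>'"
      by (rule inj_onD[OF assms[unfolded simple_grid_def] _ L[OF \<kappa>] L[OF \<kappa>']])
    show "\<kappa> = \<kappa>'"
    proof (rule PiE_ext[OF \<kappa>[unfolded mode_indices_def] \<kappa>'[unfolded mode_indices_def]])
      fix k assume k: "k \<in> {..<length ns}"
      then have "path_eigenvalue (ns ! k) (\<kappa> k) = path_eigenvalue (ns ! k) (\<kappa>' k)"
        using fun_cong[OF LL, of k] by (simp add: L_def)
      moreover have "\<kappa> k \<in> {..<ns ! k}" "\<kappa>' k \<in> {..<ns ! k}" using \<kappa> \<kappa>' k by (auto simp: mode_indices_def)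
      ultimately show "\<kappa> k = \<kappa>' k" by (rule inj_onD[OF path_eigenvalue_inj])
    qed
  qed
qed

text \<open>A product is zero iff a factor is. For several nodes the vanishing factor may depend on
  the node, which explains the order of the quantifiers.\<close>

lemma uncontrollable_grid_iff:
  assumes "simple_grid ns" "S \<subseteq> set (nodes (grid_graph ns))"
  shows "uncontrollable_eigenvector (grid_graph ns) S w x \<longleftrightarrow>
    (\<exists>\<kappa>\<in>mode_indices ns. (\<forall>i\<in>S. \<exists>k<length ns. path_mode (ns ! k) (\<kappa> k) $ (i ! k - 1) = 0) \<and>
      (\<exists>c. c \<noteq> 0 \<and> w = c \<cdot>\<^sub>v grid_mode ns \<kappa> \<and> x = grid_eigenvalue ns \<kappa>))"
proof -
  let ?G = "grid_graph ns"
  have zero: "(\<forall>a<num_nodes ?G. nodes ?G ! a \<in> S \<longrightarrow> (c \<cdot>\<^sub>v grid_mode ns \<kappa>) $ a = 0) \<longleftrightarrow>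
      (\<forall>i\<in>S. \<exists>k<length ns. path_mode (ns ! k) (\<kappa> k) $ (i ! k - 1) = 0)" if c: "c \<noteq> 0" for c \<kappa>
  proof -
    have "(c \<cdot>\<^sub>v grid_mode ns \<kappa>) $ a = 0 \<longleftrightarrow>
        (\<exists>k<length ns. path_mode (ns ! k) (\<kappa> k) $ (nodes ?G ! a ! k - 1) = 0)" if "a < num_nodes ?G" for a
      using that c by (auto simp: grid_mode_def grid_tensor_def prod_zero_iff)
    moreover have "\<exists>a<num_nodes ?G. i = nodes ?G ! a" if "i \<in> S" for i
      using that assms(2) by (metis in_set_conv_nth num_nodes_def subsetD)
    ultimately show ?thesis by metis
  qed
  show ?thesis
    unfolding uncontrollable_eigenvector_def symmetric_simple_spectrum.eigenvector_iff[OF grid_spectrum[OF assms(1)]]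
    using zero by blast
qed

subsection \<open>Uncontrollable eigenvectors of the grid\<close>

lemma eigenvalue_exists_mode:
  assumes "eigenvector (laplacian (path_graph n)) v x"
  shows "\<exists>k c. k < n \<and> c \<noteq> 0 \<and> v = c \<cdot>\<^sub>v path_mode n k \<and> x = path_eigenvalue n k"
  using assms unfolding path_eigenvector_iff by auto

text \<open>By multilinearity the scalars of all factors collect into one, so a built eigenvector is
  a scaled grid mode whose index in direction \<open>l\<close> is prescribed.\<close>

lemma built_eigenpair_iff:
  assumes l: "l < length ns" and q: "odd q" "q dvd ns ! l" "ns ! l > 0" and \<nu>: "\<nu> \<in> {1..(q - 1) div 2}"
  shows "built_eigenpair ns l q \<nu> w x \<longleftrightarrow>
    (\<exists>\<kappa>\<in>mode_indices ns. \<kappa> l = ns ! l div q * (2 * \<nu> - 1) \<and>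
      (\<exists>c. c \<noteq> 0 \<and> w = c \<cdot>\<^sub>v grid_mode ns \<kappa> \<and> x = grid_eigenvalue ns \<kappa>))" (is "_ \<longleftrightarrow> ?R")
proof
  define k0 where "k0 = ns ! l div q * (2 * \<nu> - 1)"
  have "ns ! l div q > 0" using q by (auto elim: dvdE)
  moreover have "2 * \<nu> - 1 < q" using \<nu> by auto
  ultimately have "k0 < ns ! l div q * q" unfolding k0_def by (intro mult_strict_left_mono)
  then have k0: "k0 < ns ! l" using q by simp
  have ev: "path_eigenvalue (ns ! l) k0 = N_eigenvalue q \<nu>"
    unfolding k0_def using q \<nu> by (intro N_eigenvalue_eq_path_eigenvalue) auto
  {
    assume "built_eigenpair ns l q \<nu> w x"
    then obtain u lam V where
      u: "\<forall>\<mu>\<in>{..<length ns} - {l}. eigenvector (laplacian (path_graph (ns ! \<mu>))) (u \<mu>) (lam \<mu>)" and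
      V: "is_V (ns ! l) q \<nu> V" and w: "w = grid_tensor ns (u(l := V))" and
      x: "x = N_eigenvalue q \<nu> + (\<Sum>\<mu>\<in>{..<length ns} - {l}. lam \<mu>)"
      unfolding built_eigenpair_def by blast
    from V obtain cV where cV: "cV \<noteq> 0" "V = cV \<cdot>\<^sub>v path_mode (ns ! l) k0"
      unfolding is_V_iff[OF q \<nu>] k0_def by blast
    have "\<forall>\<mu>\<in>{..<length ns} - {l}. \<exists>k c. k < ns ! \<mu> \<and> c \<noteq> 0 \<and>
        u \<mu> = c \<cdot>\<^sub>v path_mode (ns ! \<mu>) k \<and> lam \<mu> = path_eigenvalue (ns ! \<mu>) k"
      using u eigenvalue_exists_mode by blast
    then obtain \<kappa> c where \<kappa>: "\<And>\<mu>. \<mu> \<in> {..<length ns} - {l} \<Longrightarrow> \<kappa> \<mu> < ns ! \<mu> \<and> c \<mu> \<noteq> 0 \<and>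
        u \<mu> = c \<mu> \<cdot>\<^sub>v path_mode (ns ! \<mu>) (\<kappa> \<mu>) \<and> lam \<mu> = path_eigenvalue (ns ! \<mu>) (\<kappa> \<mu>)" by metis
    \<comment> \<open>The restriction is needed for membership in
      \<open>mode_indices\<close>.\<close>
    define \<kappa>' where "\<kappa>' = restrict (\<kappa>(l := k0)) {..<length ns}"
    define c' where "c' = c(l := cV)"
    have \<kappa>'l: "\<kappa>' l = k0" using l by (simp add: \<kappa>'_def)
    have \<kappa>': "\<kappa>' \<in> mode_indices ns" using \<kappa> k0 by (auto simp: \<kappa>'_def mode_indices_def)
    have "(u(l := V)) k = c' k \<cdot>\<^sub>v path_mode (ns ! k) (\<kappa>' k)" if "k < length ns" for k
      using \<kappa>[of k] cV that by (auto simp: c'_def \<kappa>'_def)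
    then have "w = grid_tensor ns (\<lambda>k. c' k \<cdot>\<^sub>v path_mode (ns ! k) (\<kappa>' k))"
      unfolding w by (rule grid_tensor_cong)
    also have "\<dots> = (\<Prod>k<length ns. c' k) \<cdot>\<^sub>v grid_mode ns \<kappa>'"
      unfolding grid_mode_def by (rule grid_tensor_smult) simp
    finally have w': "w = (\<Prod>k<length ns. c' k) \<cdot>\<^sub>v grid_mode ns \<kappa>'" .
    have "c' k \<noteq> 0" if "k < length ns" for k using \<kappa>[of k] cV that by (auto simp: c'_def)
    then have c': "(\<Prod>k<length ns. c' k) \<noteq> 0" by simp
    have "grid_eigenvalue ns \<kappa>' = path_eigenvalue (ns ! l) (\<kappa>' l) +
        (\<Sum>\<mu>\<in>{..<length ns} - {l}. path_eigenvalue (ns ! \<mu>) (\<kappa>' \<mu>))"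
      unfolding grid_eigenvalue_def using l by (intro sum.remove) auto
    also have "(\<Sum>\<mu>\<in>{..<length ns} - {l}. path_eigenvalue (ns ! \<mu>) (\<kappa>' \<mu>)) =
        (\<Sum>\<mu>\<in>{..<length ns} - {l}. lam \<mu>)"
      using \<kappa> by (intro sum.cong) (auto simp: \<kappa>'_def)
    finally have "x = grid_eigenvalue ns \<kappa>'" by (simp add: x \<kappa>'l ev)
    then show ?R using \<kappa>' \<kappa>'l w' c' unfolding k0_def by blast
  next
    assume ?R
    then obtain \<kappa> c where \<kappa>: "\<kappa> \<in> mode_indices ns" "\<kappa> l = k0"
      and c: "c \<noteq> 0" "w = c \<cdot>\<^sub>v grid_mode ns \<kappa>" "x = grid_eigenvalue ns \<kappa>" unfolding k0_def by blast
    define u where "u k = path_mode (ns ! k) (\<kappa> k)" for k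
    define lam where "lam k = path_eigenvalue (ns ! k) (\<kappa> k)" for k
    have "eigenvector (laplacian (path_graph (ns ! \<mu>))) (u \<mu>) (lam \<mu>)" if "\<mu> < length ns" for \<mu>
      unfolding u_def lam_def using \<kappa> that by (intro path_mode_eigenvector) (auto simp: mode_indices_def)
    \<comment> \<open>The whole scalar goes into the factor in direction \<open>l\<close>; the other
      factors stay unscaled modes.\<close>
    moreover have "is_V (ns ! l) q \<nu> (c \<cdot>\<^sub>v u l)"
      unfolding is_V_iff[OF q \<nu>] u_def \<kappa>(2) k0_def using c by blast
    moreover have "w = grid_tensor ns (u(l := c \<cdot>\<^sub>v u l))"
    proof -
      have "grid_tensor ns (u(l := c \<cdot>\<^sub>v u l)) = grid_tensor ns (\<lambda>k. (if k = l then c else 1) \<cdot>\<^sub>v u k)"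
        by (rule grid_tensor_cong) simp
      also have "\<dots> = (\<Prod>k<length ns. if k = l then c else 1) \<cdot>\<^sub>v grid_mode ns \<kappa>"
        unfolding grid_mode_def u_def by (rule grid_tensor_smult) simp
      also have "(\<Prod>k<length ns. if k = l then c else 1) = c" using l by simp
      finally show ?thesis unfolding c(2) by (rule sym)
    qed
    moreover have "x = N_eigenvalue q \<nu> + (\<Sum>\<mu>\<in>{..<length ns} - {l}. lam \<mu>)"
      unfolding c(3) grid_eigenvalue_def lam_def ev[symmetric] \<kappa>(2)[symmetric]
      using l by (intro sum.remove) auto
    ultimately show "built_eigenpair ns l q \<nu> w x" unfolding built_eigenpair_def by blast
  }
qed

lemma ex_built_eigenpair_iff:
  assumes q: "odd q" "q dvd ns ! l" "ns ! l > 0" and \<nu>: "\<nu> \<in> {1..(q - 1) div 2}"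
  shows "(\<exists>w. built_eigenpair ns l q \<nu> w x) \<longleftrightarrow> x \<in> shifted_eigenvalues ns l {N_eigenvalue q \<nu>}"
proof
  assume "\<exists>w. built_eigenpair ns l q \<nu> w x"
  then show "x \<in> shifted_eigenvalues ns l {N_eigenvalue q \<nu>}"
    unfolding built_eigenpair_def shifted_eigenvalues_def eigenvalue_def by blast
next
  assume "x \<in> shifted_eigenvalues ns l {N_eigenvalue q \<nu>}"
  then obtain lam where lam: "\<forall>\<mu>\<in>{..<length ns} - {l}. eigenvalue (laplacian (path_graph (ns ! \<mu>))) (lam \<mu>)"
    and x: "x = N_eigenvalue q \<nu> + (\<Sum>\<mu>\<in>{..<length ns} - {l}. lam \<mu>)"
    unfolding shifted_eigenvalues_def by blast
  obtain u where "\<forall>\<mu>\<in>{..<length ns} - {l}. eigenvector (laplacian (path_graph (ns ! \<mu>))) (u \<mu>) (lam \<mu>)"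
    using lam unfolding eigenvalue_def by metis
  moreover have "is_V (ns ! l) q \<nu> (1 \<cdot>\<^sub>v path_mode (ns ! l) (ns ! l div q * (2 * \<nu> - 1)))"
    unfolding is_V_iff[OF q \<nu>] by (intro exI[of _ 1]) simp
  ultimately show "\<exists>w. built_eigenpair ns l q \<nu> w x"
    using x unfolding built_eigenpair_def by blast
qed

lemma shifted_eigenvalues_iff:
  "x \<in> shifted_eigenvalues ns l Y \<longleftrightarrow> (\<exists>y\<in>Y. x \<in> shifted_eigenvalues ns l {y})"
  unfolding shifted_eigenvalues_def by blast

text \<open>The first centre \<open>x = (p + 1) div 2\<close> has \<open>2 * x - 1 = p\<close>,
  hence gcd \<open>p\<close> with \<open>n\<close>, and already decides. At every other centre
  \<open>2 * y - 1\<close> is an odd multiple of \<open>p\<close>, and so the zero persists.\<close>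

lemma path_mode_vanishes_on_block_centres_iff:
  assumes p: "odd p" "p dvd n" "k < n"
  shows "(\<forall>x\<in>block_centres n p. path_mode n k $ (x - 1) = 0) \<longleftrightarrow>
      (\<exists>\<nu>\<in>{1..(p - 1) div 2}. k = n div p * (2 * \<nu> - 1))" (is "?L \<longleftrightarrow> ?R")
    and "(p + 1) div 2 \<in> block_centres n p \<inter> {1..n}"
    and "path_mode n k $ ((p + 1) div 2 - 1) = 0 \<longleftrightarrow>
      (\<exists>\<nu>\<in>{1..(p - 1) div 2}. k = n div p * (2 * \<nu> - 1))"
proof -
  obtain m where m: "p = 2 * m + 1" using p by (elim oddE)
  define x where "x = (p + 1) div 2"
  have x: "x = m + 1" "2 * x - 1 = p" by (simp_all add: x_def m)
  have "p \<le> n" using p by (auto intro: dvd_imp_le)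
  then have xn: "x \<in> {1..n}" using x m by auto
  then have centre: "x \<in> block_centres n p" using block_centres_iff[OF p(1,2) xn] x by simp
  then show "(p + 1) div 2 \<in> block_centres n p \<inter> {1..n}" using xn by (simp add: x_def)
  have "gcd n (2 * x - 1) = p" using p x by (simp add: gcd_nat.absorb2)
  then have first: "path_mode n k $ (x - 1) = 0 \<longleftrightarrow> ?R" using path_mode_eq_0_iff[OF xn p(3)] by simp
  then show "path_mode n k $ ((p + 1) div 2 - 1) = 0 \<longleftrightarrow> ?R" by (simp add: x_def)
  show "?L \<longleftrightarrow> ?R"
  proof
    assume ?L
    then show ?R using centre first by blast
  next
    assume ?R
    then obtain \<nu> where \<nu>: "\<nu> \<in> {1..(p - 1) div 2}" "k = n div p * (2 * \<nu> - 1)" by blast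
    show ?L
    proof
      fix y assume y: "y \<in> block_centres n p"
      then obtain h where h: "h \<in> {1..n div p}" "y = h * p - m" by (auto simp: block_centres_def m)
      then obtain h' where h': "h = Suc h'" by (cases h) auto
      have y1: "y - 1 = h' * p + m" using h by (simp add: h' m)
      have "Suc h' * p \<le> n div p * p" using h h' by (intro mult_le_mono1) simp
      then have "Suc h' * p \<le> n" unfolding dvd_div_mult_self[OF p(2)] .
      then have "y - 1 < n" using y1 by (simp add: m)
      have "2 * (y - 1) + 1 = (2 * h' + 1) * p" unfolding y1 by (simp add: m algebra_simps)
      then have "(2 * (y - 1) + 1) * k = (n div p * p) * ((2 * h' + 1) * (2 * \<nu> - 1))"
        by (simp only: \<nu>(2) mult_ac)
      also have "n div p * p = n" using p by simp
      finally have "(2 * (y - 1) + 1) * k = n * ((2 * h' + 1) * (2 * \<nu> - 1))" .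
      moreover have "odd ((2 * h' + 1) * (2 * \<nu> - 1))" using \<nu> by simp
      ultimately have "half_cos (real k * pi / real n) (y - 1) = 0"
        using half_cos_eq_0_iff[of n k "y - 1"] p(3) by (metis gr_implies_not_zero neq0_conv)
      then show "path_mode n k $ (y - 1) = 0" using \<open>y - 1 < n\<close> by (simp add: path_mode_def)
    qed
  qed
qed

lemma uncontrollable_centre_nodes_iff:
  assumes simple: "simple_grid ns" and pos: "\<forall>n\<in>set ns. 1 \<le> n"
    and l: "l < length ns" and p: "odd p" "p dvd ns ! l"
  shows "uncontrollable_eigenvector (grid_graph ns) (centre_nodes ns l p) w x \<longleftrightarrow>
    (\<exists>\<nu>\<in>{1..(p - 1) div 2}. built_eigenpair ns l p \<nu> w x)"
proof -
  have nl: "ns ! l > 0" using pos l by (metis One_nat_def Suc_le_eq nth_mem)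
  have sub: "centre_nodes ns l p \<subseteq> set (nodes (grid_graph ns))" by (auto simp: centre_nodes_def)
  have zero: "(\<forall>i\<in>centre_nodes ns l p. \<exists>k<length ns. path_mode (ns ! k) (\<kappa> k) $ (i ! k - 1) = 0) \<longleftrightarrow>
      (\<exists>\<nu>\<in>{1..(p - 1) div 2}. \<kappa> l = ns ! l div p * (2 * \<nu> - 1))" (is "?L \<longleftrightarrow> ?R")
    if \<kappa>: "\<kappa> \<in> mode_indices ns" for \<kappa>
  proof
    have \<kappa>k: "\<kappa> k < ns ! k" if "k < length ns" for k using \<kappa> that by (auto simp: mode_indices_def)
    note centres = path_mode_vanishes_on_block_centres_iff[OF p \<kappa>k[OF l]]
    {
      assume L: ?L
      \<comment> \<open>A test node: the first block centre in direction \<open>l\<close> and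
        coordinate 1 elsewhere. No path mode vanishes at coordinate 1, so the zero must come from
        direction \<open>l\<close>.\<close>
      define i where "i = (replicate (length ns) 1)[l := (p + 1) div 2]"
      have "i \<in> set (nodes (grid_graph ns))"
        using pos centres(2) l by (auto simp: in_nodes_grid_graph_iff i_def nth_list_update)
      then have "i \<in> centre_nodes ns l p" using centres(2) l by (auto simp: centre_nodes_def i_def)
      then obtain k where k: "k < length ns" "path_mode (ns ! k) (\<kappa> k) $ (i ! k - 1) = 0" using L by blast
      have "k = l"
      proof (rule ccontr)
        assume "k \<noteq> l"
        then have "i ! k - 1 = 0" using k by (simp add: i_def)
        then show False using k path_mode_nonzero_first[OF \<kappa>k[OF k(1)]] by simp
      qed
      then show ?R using k centres(3) l by (simp add: i_def)
    next
      assume ?R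
      then have "\<forall>x\<in>block_centres (ns ! l) p. path_mode (ns ! l) (\<kappa> l) $ (x - 1) = 0" using centres(1) by blast
      then show ?L using l by (auto simp: centre_nodes_def)
    }
  qed
  define M where "M \<kappa> \<longleftrightarrow> (\<exists>c. c \<noteq> 0 \<and> w = c \<cdot>\<^sub>v grid_mode ns \<kappa> \<and> x = grid_eigenvalue ns \<kappa>)" for \<kappa>
  have "uncontrollable_eigenvector (grid_graph ns) (centre_nodes ns l p) w x \<longleftrightarrow>
      (\<exists>\<nu>\<in>{1..(p - 1) div 2}. \<exists>\<kappa>\<in>mode_indices ns. \<kappa> l = ns ! l div p * (2 * \<nu> - 1) \<and> M \<kappa>)"
    unfolding uncontrollable_grid_iff[OF simple sub] M_def[symmetric] using zero by blast
  also have "\<dots> \<longleftrightarrow> (\<exists>\<nu>\<in>{1..(p - 1) div 2}. built_eigenpair ns l p \<nu> w x)"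
    by (intro bex_cong[OF refl]) (simp only: built_eigenpair_iff[OF l p nl] M_def)
  finally show ?thesis .
qed

lemma uncontrollable_node_iff:
  assumes simple: "simple_grid ns" and i: "i \<in> set (nodes (grid_graph ns))"
  defines "g \<equiv> \<lambda>l. gcd (ns ! l) (2 * i ! l - 1)"
  shows "uncontrollable_eigenvector (grid_graph ns) {i} w x \<longleftrightarrow>
    (\<exists>l<length ns. \<exists>\<nu>\<in>{1..(g l - 1) div 2}. built_eigenpair ns l (g l) \<nu> w x)"
proof -
  have il: "i ! l \<in> {1..ns ! l}" if "l < length ns" for l using i that by (simp add: in_nodes_grid_graph_iff)
  have g: "odd (g l)" "g l dvd ns ! l" "ns ! l > 0" if "l < length ns" for l
  proof -
    show "ns ! l > 0" using il[OF that] by simp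
    have "odd (2 * i ! l - 1)" using il[OF that] odd_two_mult_minus_1 by simp
    then show "odd (g l)" unfolding g_def by (meson dvd_trans gcd_dvd2)
    show "g l dvd ns ! l" by (simp add: g_def)
  qed
  have zero: "(\<exists>l<length ns. path_mode (ns ! l) (\<kappa> l) $ (i ! l - 1) = 0) \<longleftrightarrow>
      (\<exists>l<length ns. \<exists>\<nu>\<in>{1..(g l - 1) div 2}. \<kappa> l = ns ! l div g l * (2 * \<nu> - 1))"
    if "\<kappa> \<in> mode_indices ns" for \<kappa>
  proof -
    have "\<kappa> l < ns ! l" if "l < length ns" for l using that \<open>\<kappa> \<in> mode_indices ns\<close> by (auto simp: mode_indices_def)
    then show ?thesis using path_mode_eq_0_iff[OF il] unfolding g_def by blast
  qed
  define M where "M \<kappa> \<longleftrightarrow> (\<exists>c. c \<noteq> 0 \<and> w = c \<cdot>\<^sub>v grid_mode ns \<kappa> \<and> x = grid_eigenvalue ns \<kappa>)" for \<kappa>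
  have "uncontrollable_eigenvector (grid_graph ns) {i} w x \<longleftrightarrow>
      (\<exists>\<kappa>\<in>mode_indices ns. (\<exists>l<length ns. path_mode (ns ! l) (\<kappa> l) $ (i ! l - 1) = 0) \<and> M \<kappa>)"
    using uncontrollable_grid_iff[OF simple, of "{i}" w x] i by (simp add: M_def)
  also have "\<dots> \<longleftrightarrow> (\<exists>l<length ns. \<exists>\<nu>\<in>{1..(g l - 1) div 2}. \<exists>\<kappa>\<in>mode_indices ns.
      \<kappa> l = ns ! l div g l * (2 * \<nu> - 1) \<and> M \<kappa>)"
    using zero by blast
  also have "\<dots> \<longleftrightarrow> (\<exists>l<length ns. \<exists>\<nu>\<in>{1..(g l - 1) div 2}. built_eigenpair ns l (g l) \<nu> w x)"
    by (intro ex_cong1 conj_cong[OF refl] bex_cong[OF refl]) (simp only: built_eigenpair_iff[OF _ g] M_def)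
  finally show ?thesis .
qed

text \<open>A prime as required exists iff the gcd is not 1, and since it is odd this means that it
  is at least 3. The right side is phrased so as to provide the witness
  \<open>\<nu> = 1\<close>.\<close>

lemma ex_symmetric_mod_iff:
  assumes "x \<in> {1..n}"
  shows "(\<exists>p. symmetric_mod n x p) \<longleftrightarrow> 1 \<in> {1..(gcd n (2 * x - 1) - 1) div 2}"
proof -
  let ?g = "gcd n (2 * x - 1)"
  have "odd (2 * x - 1)" using assms odd_two_mult_minus_1 by simp
  then have "odd ?g" by (meson dvd_trans gcd_dvd2)
  have "(\<exists>p. symmetric_mod n x p) \<longleftrightarrow> ?g \<noteq> 1"
    unfolding symmetric_mod_iff[OF assms] using prime_factor_nat[of ?g] not_prime_unit by metis
  also have "\<dots> \<longleftrightarrow> 1 \<in> {1..(?g - 1) div 2}" using \<open>odd ?g\<close> by (elim oddE) auto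
  finally show ?thesis .
qed

theorem mainTheorem1:
  fixes ns :: "nat list"
  assumes "ns \<noteq> []"
    and "\<forall>n\<in>set ns. 1 \<le> n"
    and "simple_grid ns"
  shows
    "(\<forall>i\<in>set (nodes (grid_graph ns)).
        (\<not> controllable_from (grid_graph ns) {i} \<longleftrightarrow>
           (\<exists>l<length ns. \<exists>p. symmetric_mod (ns ! l) (i ! l) p)) \<and>
        (\<not> observable_from (grid_graph ns) {i} \<longleftrightarrow>
           (\<exists>l<length ns. \<exists>p. symmetric_mod (ns ! l) (i ! l) p)))
     \<and>
     (\<forall>l<length ns. \<forall>p. prime p \<and> odd p \<and> p dvd ns ! l \<longrightarrow>
        \<not> controllable_from (grid_graph ns) (centre_nodes ns l p) \<and>
        \<not> observable_from (grid_graph ns) (centre_nodes ns l p) \<and>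
        {x. uncontrollable_eigenvalue (grid_graph ns) (centre_nodes ns l p) x} =
          shifted_eigenvalues ns l {N_eigenvalue p \<nu> | \<nu>. \<nu> \<in> {1..(p - 1) div 2}} \<and>
        {x. unobservable_eigenvalue (grid_graph ns) (centre_nodes ns l p) x} =
          shifted_eigenvalues ns l {N_eigenvalue p \<nu> | \<nu>. \<nu> \<in> {1..(p - 1) div 2}} \<and>
        (\<forall>w x. uncontrollable_eigenvector (grid_graph ns) (centre_nodes ns l p) w x \<longleftrightarrow>
          (\<exists>\<nu>\<in>{1..(p - 1) div 2}. built_eigenpair ns l p \<nu> w x)) \<and>
        (\<forall>w x. unobservable_eigenvector (grid_graph ns) (centre_nodes ns l p) w x \<longleftrightarrow>
          (\<exists>\<nu>\<in>{1..(p - 1) div 2}. built_eigenpair ns l p \<nu> w x)))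
     \<and>
     (\<forall>i\<in>set (nodes (grid_graph ns)).
      \<forall>(r::nat) (R::nat set) (k::nat \<Rightarrow> nat) (q::nat \<Rightarrow> nat \<Rightarrow> nat) (Q::nat \<Rightarrow> nat).
        R = {l. l < length ns \<and> (\<exists>p. symmetric_mod (ns ! l) (i ! l) p)} \<and>
        card R = r \<and> 1 \<le> r \<and> r \<le> length ns \<and>
        (\<forall>l\<in>R. bij_betw (q l) {1..k l} {p. symmetric_mod (ns ! l) (i ! l) p}) \<and>
        (\<forall>l\<in>R. Q l = (\<Prod>j=1..k l. q l j ^ max_exponent (ns ! l) (i ! l) (q l j)))
        \<longrightarrow>
        (\<forall>l\<in>R.
          {x. uncontrollable_eigenvalue (path_graph (ns ! l)) {i ! l} x} =
            {N_eigenvalue (Q l) \<nu> | \<nu>. \<nu> \<in> {1..(Q l - 1) div 2}} \<and>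
          {x. unobservable_eigenvalue (path_graph (ns ! l)) {i ! l} x} =
            {N_eigenvalue (Q l) \<nu> | \<nu>. \<nu> \<in> {1..(Q l - 1) div 2}}) \<and>
        {x. uncontrollable_eigenvalue (grid_graph ns) {i} x} =
          (\<Union>l\<in>R. shifted_eigenvalues ns l
             {x. uncontrollable_eigenvalue (path_graph (ns ! l)) {i ! l} x}) \<and>
        {x. unobservable_eigenvalue (grid_graph ns) {i} x} =
          (\<Union>l\<in>R. shifted_eigenvalues ns l
             {x. unobservable_eigenvalue (path_graph (ns ! l)) {i ! l} x}) \<and>
        (\<forall>w x. uncontrollable_eigenvector (grid_graph ns) {i} w x \<longleftrightarrow>
          (\<exists>l\<in>R. \<exists>\<nu>\<in>{1..(Q l - 1) div 2}. built_eigenpair ns l (Q l) \<nu> w x)) \<and>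
        (\<forall>w x. unobservable_eigenvector (grid_graph ns) {i} w x \<longleftrightarrow>
          (\<exists>l\<in>R. \<exists>\<nu>\<in>{1..(Q l - 1) div 2}. built_eigenpair ns l (Q l) \<nu> w x)))"
proof -
  let ?G = "grid_graph ns"
  define sm where "sm i l = (\<exists>p. symmetric_mod (ns ! l) (i ! l) p)" for i l
  define g where "g i l = gcd (ns ! l) (2 * i ! l - 1)" for i l
  note simple = assms(3)
  have pos: "ns ! l > 0" if "l < length ns" for l using assms(2) that by (metis One_nat_def Suc_le_eq nth_mem)
  then have "num_nodes ?G \<noteq> 0" by (simp add: num_nodes_grid_graph)
  note ctrl = controllable_from_iff[OF grid_spectrum[OF simple] this]
  have il: "i ! l \<in> {1..ns ! l}" if "i \<in> set (nodes ?G)" "l < length ns" for i l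
    using that by (simp add: in_nodes_grid_graph_iff)
  have g: "odd (g i l)" "g i l dvd ns ! l" if "i \<in> set (nodes ?G)" "l < length ns" for i l
  proof -
    have "odd (2 * i ! l - 1)" using il[OF that] odd_two_mult_minus_1 by simp
    then show "odd (g i l)" unfolding g_def by (meson dvd_trans gcd_dvd2)
  qed (simp add: g_def)
  have sm: "sm i l \<longleftrightarrow> 1 \<in> {1..(g i l - 1) div 2}" if "i \<in> set (nodes ?G)" "l < length ns" for i l
    unfolding sm_def g_def by (rule ex_symmetric_mod_iff[OF il[OF that]])
  have node: "uncontrollable_eigenvector ?G {i} w x \<longleftrightarrow>
      (\<exists>l\<in>{l. l < length ns \<and> sm i l}. \<exists>\<nu>\<in>{1..(g i l - 1) div 2}. built_eigenpair ns l (g i l) \<nu> w x)"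
    if i: "i \<in> set (nodes ?G)" for i w x
  proof -
    \<comment> \<open>In a direction without symmetry the range of \<open>\<nu>\<close> is empty, so
      nothing is lost by leaving it out.\<close>
    have "sm i l" if "l < length ns" "\<nu> \<in> {1..(g i l - 1) div 2}" for l \<nu>
      unfolding sm[OF i that(1)] using that(2) by auto
    then show ?thesis using uncontrollable_node_iff[OF simple i, of w x] unfolding g_def[symmetric] by blast
  qed
  have ex_built: "\<exists>w x. built_eigenpair ns l q \<nu> w x"
    if "l < length ns" "odd q" "q dvd ns ! l" "\<nu> \<in> {1..(q - 1) div 2}" for l q \<nu>
  proof -
    \<comment> \<open>Index 0 belongs to the constant mode, which every path of positive length
      has.\<close>
    have "eigenvalue (laplacian (path_graph (ns ! \<mu>))) (path_eigenvalue (ns ! \<mu>) 0)" if "\<mu> < length ns" for \<mu>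
      using path_eigenvalue_iff pos[OF that] by blast
    then have "N_eigenvalue q \<nu> + (\<Sum>\<mu>\<in>{..<length ns} - {l}. path_eigenvalue (ns ! \<mu>) 0)
        \<in> shifted_eigenvalues ns l {N_eigenvalue q \<nu>}"
      unfolding shifted_eigenvalues_def
      by (intro CollectI exI[of _ "N_eigenvalue q \<nu>"] exI[of _ "\<lambda>\<mu>. path_eigenvalue (ns ! \<mu>) 0"]) simp
    then show ?thesis using ex_built_eigenpair_iff[OF that(2,3) pos[OF that(1)] that(4)] by blast
  qed
  have uncontrollable_node: "(\<exists>w x. uncontrollable_eigenvector ?G {i} w x) \<longleftrightarrow> (\<exists>l<length ns. sm i l)"
    if i: "i \<in> set (nodes ?G)" for i
  proof
    assume "\<exists>l<length ns. sm i l"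
    then obtain l where l: "l < length ns" "sm i l" by blast
    then have "1 \<in> {1..(g i l - 1) div 2}" using sm[OF i] by simp
    then show "\<exists>w x. uncontrollable_eigenvector ?G {i} w x"
      unfolding node[OF i] using ex_built[OF l(1) g[OF i l(1)]] l by blast
  next
    assume "\<exists>w x. uncontrollable_eigenvector ?G {i} w x"
    then obtain w x where "uncontrollable_eigenvector ?G {i} w x" by blast
    then show "\<exists>l<length ns. sm i l" unfolding node[OF i] by auto
  qed
  have shifted: "{x. \<exists>w. \<exists>\<nu>\<in>{1..(q - 1) div 2}. built_eigenpair ns l q \<nu> w x} =
      shifted_eigenvalues ns l {N_eigenvalue q \<nu> | \<nu>. \<nu> \<in> {1..(q - 1) div 2}}"
    if "l < length ns" "odd q" "q dvd ns ! l" for l q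
  proof -
    have "x \<in> shifted_eigenvalues ns l {N_eigenvalue q \<nu> | \<nu>. \<nu> \<in> {1..(q - 1) div 2}} \<longleftrightarrow>
        (\<exists>\<nu>\<in>{1..(q - 1) div 2}. x \<in> shifted_eigenvalues ns l {N_eigenvalue q \<nu>})" for x
      by (subst shifted_eigenvalues_iff) blast
    then show ?thesis using ex_built_eigenpair_iff[OF that(2,3) pos[OF that(1)]] by blast
  qed
  have one: "\<forall>i\<in>set (nodes ?G).
      (\<not> controllable_from ?G {i} \<longleftrightarrow> (\<exists>l<length ns. sm i l)) \<and>
      (\<not> observable_from ?G {i} \<longleftrightarrow> (\<exists>l<length ns. sm i l))"
    using ctrl uncontrollable_node by simp
  have two: "\<not> controllable_from ?G (centre_nodes ns l p) \<and>
      \<not> observable_from ?G (centre_nodes ns l p) \<and>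
      {x. uncontrollable_eigenvalue ?G (centre_nodes ns l p) x} =
        shifted_eigenvalues ns l {N_eigenvalue p \<nu> | \<nu>. \<nu> \<in> {1..(p - 1) div 2}} \<and>
      (\<forall>w x. uncontrollable_eigenvector ?G (centre_nodes ns l p) w x \<longleftrightarrow>
        (\<exists>\<nu>\<in>{1..(p - 1) div 2}. built_eigenpair ns l p \<nu> w x))"
    if l: "l < length ns" and p: "prime p \<and> odd p \<and> p dvd ns ! l" for l p
  proof -
    have vec: "uncontrollable_eigenvector ?G (centre_nodes ns l p) w x \<longleftrightarrow>
        (\<exists>\<nu>\<in>{1..(p - 1) div 2}. built_eigenpair ns l p \<nu> w x)" for w x
      using uncontrollable_centre_nodes_iff[OF simple assms(2) l] p by blast
    have "p \<ge> 3" using p prime_ge_2_nat[of p] by (cases "p = 2") auto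
    then have "1 \<in> {1..(p - 1) div 2}" by auto
    then have "\<exists>w x. uncontrollable_eigenvector ?G (centre_nodes ns l p) w x"
      unfolding vec using ex_built[OF l, of p 1] p by blast
    moreover have "{x. uncontrollable_eigenvalue ?G (centre_nodes ns l p) x} =
        shifted_eigenvalues ns l {N_eigenvalue p \<nu> | \<nu>. \<nu> \<in> {1..(p - 1) div 2}}"
      unfolding uncontrollable_eigenvalue_def vec using shifted[OF l] p by blast
    ultimately show ?thesis using ctrl vec by simp
  qed
  have three: "(\<forall>l\<in>R.
        {x. uncontrollable_eigenvalue (path_graph (ns ! l)) {i ! l} x} =
          {N_eigenvalue (Q l) \<nu> | \<nu>. \<nu> \<in> {1..(Q l - 1) div 2}}) \<and>
      {x. uncontrollable_eigenvalue ?G {i} x} =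
        (\<Union>l\<in>R. shifted_eigenvalues ns l {x. uncontrollable_eigenvalue (path_graph (ns ! l)) {i ! l} x}) \<and>
      (\<forall>w x. uncontrollable_eigenvector ?G {i} w x \<longleftrightarrow>
        (\<exists>l\<in>R. \<exists>\<nu>\<in>{1..(Q l - 1) div 2}. built_eigenpair ns l (Q l) \<nu> w x))"
    if i: "i \<in> set (nodes ?G)" and R: "R = {l. l < length ns \<and> sm i l}"
      and q: "\<forall>l\<in>R. bij_betw (q l) {1..k l} {p. symmetric_mod (ns ! l) (i ! l) p}"
      and Q: "\<forall>l\<in>R. Q l = (\<Prod>j=1..k l. q l j ^ max_exponent (ns ! l) (i ! l) (q l j))"
    for i R and k Q :: "nat \<Rightarrow> nat" and q :: "nat \<Rightarrow> nat \<Rightarrow> nat"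
  proof -
    have Rl: "l < length ns" if "l \<in> R" for l using that R by simp
    \<comment> \<open>The product over the prime factors is the gcd, so all that is known for
      \<open>g i l\<close> carries over to \<open>Q l\<close>.\<close>
    have Qg: "Q l = g i l" if "l \<in> R" for l
      using prod_max_exponent[OF il[OF i Rl[OF that]] bspec[OF q that]] bspec[OF Q that]
      unfolding g_def by (rule trans[rotated])
    have path: "{x. uncontrollable_eigenvalue (path_graph (ns ! l)) {i ! l} x} =
        {N_eigenvalue (Q l) \<nu> | \<nu>. \<nu> \<in> {1..(Q l - 1) div 2}}" if "l \<in> R" for l
      unfolding Qg[OF that] g_def by (rule uncontrollable_eigenvalues_path[OF il[OF i Rl[OF that]]])
    have vec: "uncontrollable_eigenvector ?G {i} w x \<longleftrightarrow>
        (\<exists>l\<in>R. \<exists>\<nu>\<in>{1..(Q l - 1) div 2}. built_eigenpair ns l (Q l) \<nu> w x)" for w x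
      unfolding node[OF i] R[symmetric] using Qg by simp
    have "{x. uncontrollable_eigenvalue ?G {i} x} =
        (\<Union>l\<in>R. {x. \<exists>w. \<exists>\<nu>\<in>{1..(Q l - 1) div 2}. built_eigenpair ns l (Q l) \<nu> w x})"
      unfolding uncontrollable_eigenvalue_def vec by blast
    also have "\<dots> = (\<Union>l\<in>R. shifted_eigenvalues ns l {x. uncontrollable_eigenvalue (path_graph (ns ! l)) {i ! l} x})"
    proof (rule SUP_cong[OF refl])
      fix l assume l: "l \<in> R"
      show "{x. \<exists>w. \<exists>\<nu>\<in>{1..(Q l - 1) div 2}. built_eigenpair ns l (Q l) \<nu> w x} =
          shifted_eigenvalues ns l {x. uncontrollable_eigenvalue (path_graph (ns ! l)) {i ! l} x}"
        unfolding path[OF l] using Qg[OF l] g[OF i Rl[OF l]] by (intro shifted Rl[OF l]) simp_all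
    qed
    finally show ?thesis using path vec by blast
  qed
  show ?thesis
    unfolding unobservable_eq_uncontrollable
  proof (intro conjI[OF _ conjI])
    show "\<forall>i\<in>set (nodes ?G).
      (\<not> controllable_from ?G {i} \<longleftrightarrow> (\<exists>l<length ns. \<exists>p. symmetric_mod (ns ! l) (i ! l) p)) \<and>
      (\<not> observable_from ?G {i} \<longleftrightarrow> (\<exists>l<length ns. \<exists>p. symmetric_mod (ns ! l) (i ! l) p))"
      using one unfolding sm_def .
  next
    show "\<forall>l<length ns. \<forall>p. prime p \<and> odd p \<and> p dvd ns ! l \<longrightarrow>
        \<not> controllable_from ?G (centre_nodes ns l p) \<and>
        \<not> observable_from ?G (centre_nodes ns l p) \<and>
        {x. uncontrollable_eigenvalue ?G (centre_nodes ns l p) x} =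
          shifted_eigenvalues ns l {N_eigenvalue p \<nu> | \<nu>. \<nu> \<in> {1..(p - 1) div 2}} \<and>
        {x. uncontrollable_eigenvalue ?G (centre_nodes ns l p) x} =
          shifted_eigenvalues ns l {N_eigenvalue p \<nu> | \<nu>. \<nu> \<in> {1..(p - 1) div 2}} \<and>
        (\<forall>w x. uncontrollable_eigenvector ?G (centre_nodes ns l p) w x \<longleftrightarrow>
          (\<exists>\<nu>\<in>{1..(p - 1) div 2}. built_eigenpair ns l p \<nu> w x)) \<and>
        (\<forall>w x. uncontrollable_eigenvector ?G (centre_nodes ns l p) w x \<longleftrightarrow>
          (\<exists>\<nu>\<in>{1..(p - 1) div 2}. built_eigenpair ns l p \<nu> w x))"
      using two by (intro allI impI) blast
  next
    show "\<forall>i\<in>set (nodes ?G). \<forall>(r::nat) (R::nat set) (k::nat \<Rightarrow> nat) (q::nat \<Rightarrow> nat \<Rightarrow> nat) (Q::nat \<Rightarrow> nat).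
        R = {l. l < length ns \<and> (\<exists>p. symmetric_mod (ns ! l) (i ! l) p)} \<and>
        card R = r \<and> 1 \<le> r \<and> r \<le> length ns \<and>
        (\<forall>l\<in>R. bij_betw (q l) {1..k l} {p. symmetric_mod (ns ! l) (i ! l) p}) \<and>
        (\<forall>l\<in>R. Q l = (\<Prod>j=1..k l. q l j ^ max_exponent (ns ! l) (i ! l) (q l j)))
        \<longrightarrow>
        (\<forall>l\<in>R.
          {x. uncontrollable_eigenvalue (path_graph (ns ! l)) {i ! l} x} =
            {N_eigenvalue (Q l) \<nu> | \<nu>. \<nu> \<in> {1..(Q l - 1) div 2}} \<and>
          {x. uncontrollable_eigenvalue (path_graph (ns ! l)) {i ! l} x} =
            {N_eigenvalue (Q l) \<nu> | \<nu>. \<nu> \<in> {1..(Q l - 1) div 2}}) \<and>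
        {x. uncontrollable_eigenvalue ?G {i} x} =
          (\<Union>l\<in>R. shifted_eigenvalues ns l
             {x. uncontrollable_eigenvalue (path_graph (ns ! l)) {i ! l} x}) \<and>
        {x. uncontrollable_eigenvalue ?G {i} x} =
          (\<Union>l\<in>R. shifted_eigenvalues ns l
             {x. uncontrollable_eigenvalue (path_graph (ns ! l)) {i ! l} x}) \<and>
        (\<forall>w x. uncontrollable_eigenvector ?G {i} w x \<longleftrightarrow>
          (\<exists>l\<in>R. \<exists>\<nu>\<in>{1..(Q l - 1) div 2}. built_eigenpair ns l (Q l) \<nu> w x)) \<and>
        (\<forall>w x. uncontrollable_eigenvector ?G {i} w x \<longleftrightarrow>
          (\<exists>l\<in>R. \<exists>\<nu>\<in>{1..(Q l - 1) div 2}. built_eigenpair ns l (Q l) \<nu> w x))"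
    proof (intro ballI allI impI, elim conjE)
      fix i r R and k Q :: "nat \<Rightarrow> nat" and q :: "nat \<Rightarrow> nat \<Rightarrow> nat"
      assume "i \<in> set (nodes ?G)"
        and "R = {l. l < length ns \<and> (\<exists>p. symmetric_mod (ns ! l) (i ! l) p)}"
        and "\<forall>l\<in>R. bij_betw (q l) {1..k l} {p. symmetric_mod (ns ! l) (i ! l) p}"
        and "\<forall>l\<in>R. Q l = (\<Prod>j=1..k l. q l j ^ max_exponent (ns ! l) (i ! l) (q l j))"
      note * = three[unfolded sm_def, OF this]
      show "(\<forall>l\<in>R.
          {x. uncontrollable_eigenvalue (path_graph (ns ! l)) {i ! l} x} =
            {N_eigenvalue (Q l) \<nu> | \<nu>. \<nu> \<in> {1..(Q l - 1) div 2}} \<and>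
          {x. uncontrollable_eigenvalue (path_graph (ns ! l)) {i ! l} x} =
            {N_eigenvalue (Q l) \<nu> | \<nu>. \<nu> \<in> {1..(Q l - 1) div 2}}) \<and>
        {x. uncontrollable_eigenvalue ?G {i} x} =
          (\<Union>l\<in>R. shifted_eigenvalues ns l
             {x. uncontrollable_eigenvalue (path_graph (ns ! l)) {i ! l} x}) \<and>
        {x. uncontrollable_eigenvalue ?G {i} x} =
          (\<Union>l\<in>R. shifted_eigenvalues ns l
             {x. uncontrollable_eigenvalue (path_graph (ns ! l)) {i ! l} x}) \<and>
        (\<forall>w x. uncontrollable_eigenvector ?G {i} w x \<longleftrightarrow>
          (\<exists>l\<in>R. \<exists>\<nu>\<in>{1..(Q l - 1) div 2}. built_eigenpair ns l (Q l) \<nu> w x)) \<and>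
        (\<forall>w x. uncontrollable_eigenvector ?G {i} w x \<longleftrightarrow>
          (\<exists>l\<in>R. \<exists>\<nu>\<in>{1..(Q l - 1) div 2}. built_eigenpair ns l (Q l) \<nu> w x))"
        \<comment> \<open>The claims on observability have become copies of those on
          controllability; removing the repetitions leaves \<open>*\<close>.\<close>
        unfolding conj_absorb conj_left_absorb by (rule *)
    qed
  qed
qed

end
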